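(* Let $R_X$ and $R_Y$ be injective YBE solutions on sets $X$ and $Y$, with structure groups $G_X,G_Y$, derived structure groups $A_X,A_Y$ and associated regular affine actions $\rho^X:G_X\to\mathrm{Aff}(A_X)$, $\rho^Y:G_Y\to\mathrm{Aff}(A_Y)$. Then $R_X$ and $R_Y$ are isomorphic if and only if there is a group isomorphism $\phi:G_X\to G_Y$ such that $\phi(X)=Y$ and the affine actions $\rho^X$ and $\rho^Y\circ\phi$ of $G_X$ (on $A_X$ and $A_Y$ respectively) are conjugate.
   Context: YBE solutions. A YBE solution on a non-empty set $X$ is a bijection $R:X^2\to X^2$, written $R(x,y)=(\alpha_x(y),\beta_y(x))$, satisfying $(R\times\mathrm{id})(\mathrm{id}\times R)(R\times\mathrm{id})=(\mathrm{id}\times R)(R\times\mathrm{id})(\mathrm{id}\times R)$ on $X^3$, and non-degenerate, i.e. all $\alpha_x,\beta_x$ ($x\in X$) are bijections of $X$. The solution is denoted $R_X$. Groups. The structure group $G_X$ is the group generated by $X$ with relations $xy=\alpha_x(y)\beta_y(x)$ ($x,y\in X$). The derived structure group $A_X$ (product written $\bullet$) is the group generated by $X$ with relations $x\bullet y=y\bullet\alpha_y(\beta_{\alpha_x^{-1}(y)}(x))$ ($x,y\in X$). $R_X$ is called injective if the natural map $X\to G_X$ is injective (equivalently, it is known, if $X\to A_X$ is injective); then $X$ is regarded as a subset of $G_X$ and of $A_X$. Affine actions. For a group $A$, $\mathrm{Aff}(A)=\mathrm{Aut}(A)\ltimes A$ with $(S,a)(T,b)=(ST,aS(b))$, acting on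 $A$ by $(S,a)b=aS(b)$. An affine action of $G$ on $A$ is a group homomorphism $\rho:G\to\mathrm{Aff}(A)$; it has the form $\rho_g(a)=b(g)\pi_g(a)$ with $\pi:G\to\mathrm{Aut}(A)$ a homomorphism and $b:G\to A$ satisfying $b(gh)=b(g)\pi_g(b(h))$; write $\rho=(\pi,b)$. It is regular if it is transitive and free on $A$ (equivalently, $b$ is bijective). Affine actions $\rho^1,\rho^2$ of $G$ on $A_1,A_2$ are conjugate if there is a group isomorphism $\varphi:A_1\to A_2$ with $\varphi\circ\rho^1_g=\rho^2_g\circ\varphi$ for all $g\in G$. Associated affine action. It is known that $x\mapsto\alpha_x$ extends to a left action of $G_X$ on $X$, and that each $\alpha_g$ extends to an automorphism of $A_X$, giving a homomorphism $\alpha^X:G_X\to\mathrm{Aut}(A_X)$. The affine action associated to $R_X$ is $\rho^X=(\alpha^X,b^X)$, where $b^X:G_X\to A_X$ is the 1-cocycle with respect to $\alpha^X$ (i.e. $b^X(gh)=b^X(g)\bullet\alpha^X_g(b^X(h))$) determined by $b^X(x)=x$ for $x\in X$; it is a regular affine action of $G_X$ on $A_X$. Isomorphism. $R_X$ and $R_Y$ are isomorphic if there is a bijection $h:X\to Y$ with $R_Y(h\times h)=(h\times h)R_X$. *)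

theory Defs
  imports "HOL-Algebra.Bij"
begin

section \<open>Set-theoretic Yang--Baxter solutions\<close>

type_synonym 'a pair_map = "'a \<times> 'a \<Rightarrow> 'a \<times> 'a"

text \<open>A solution is a map on pairs of which only the restriction to \<open>X \<times> X\<close> matters;
  \<open>R (x, y) = (ybe_alpha R x y, ybe_beta R y x)\<close>.\<close>

definition ybe_alpha :: "'a pair_map \<Rightarrow> 'a \<Rightarrow> 'a \<Rightarrow> 'a"
  where "ybe_alpha R x y = fst (R (x, y))"

definition ybe_beta :: "'a pair_map \<Rightarrow> 'a \<Rightarrow> 'a \<Rightarrow> 'a"
  where "ybe_beta R y x = snd (R (x, y))"

definition R_times_id :: "'a pair_map \<Rightarrow> 'a \<times> 'a \<times> 'a \<Rightarrow> 'a \<times> 'a \<times> 'a"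
  where "R_times_id R = (\<lambda>(x, y, z). case R (x, y) of (u, v) \<Rightarrow> (u, v, z))"

definition id_times_R :: "'a pair_map \<Rightarrow> 'a \<times> 'a \<times> 'a \<Rightarrow> 'a \<times> 'a \<times> 'a"
  where "id_times_R R = map_prod id R"

definition ybe_solution :: "'a set \<Rightarrow> 'a pair_map \<Rightarrow> bool"
  where "ybe_solution X R \<longleftrightarrow>
    X \<noteq> {} \<and>
    bij_betw R (X \<times> X) (X \<times> X) \<and>
    (\<forall>t \<in> X \<times> X \<times> X.
      (R_times_id R \<circ> id_times_R R \<circ> R_times_id R) t =
      (id_times_R R \<circ> R_times_id R \<circ> id_times_R R) t) \<and>
    (\<forall>x\<in>X. bij_betw (ybe_alpha R x) X X) \<and>
    (\<forall>x\<in>X. bij_betw (ybe_beta R x) X X)"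

definition ybe_isomorphic :: "'a set \<Rightarrow> 'a pair_map \<Rightarrow> 'b set \<Rightarrow> 'b pair_map \<Rightarrow> bool"
  where "ybe_isomorphic X R Y S \<longleftrightarrow>
    (\<exists>h. bij_betw h X Y \<and> (\<forall>p \<in> X \<times> X. S (map_prod h h p) = map_prod h h (R p)))"


section \<open>Groups given by generators and relations\<close>

text \<open>A letter \<open>(x, True)\<close> stands for the generator \<open>x\<close> and \<open>(x, False)\<close> for its formal
  inverse; a pair \<open>(l, r)\<close> of words in the set of relations stands for the relation \<open>l = r\<close>.\<close>

type_synonym 'a gword = "('a \<times> bool) list"

abbreviation gwords :: "'a set \<Rightarrow> 'a gword set"
  where "gwords X \<equiv> lists (X \<times> UNIV)"

inductive_set pres_cong :: "'a set \<Rightarrow> ('a gword \<times> 'a gword) set \<Rightarrow> ('a gword \<times> 'a gword) set"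
  for X :: "'a set" and Rel :: "('a gword \<times> 'a gword) set" where
  refl: "w \<in> gwords X \<Longrightarrow> (w, w) \<in> pres_cong X Rel"
| sym: "(v, w) \<in> pres_cong X Rel \<Longrightarrow> (w, v) \<in> pres_cong X Rel"
| trans: "(u, v) \<in> pres_cong X Rel \<Longrightarrow> (v, w) \<in> pres_cong X Rel \<Longrightarrow> (u, w) \<in> pres_cong X Rel"
| cancel: "u \<in> gwords X \<Longrightarrow> v \<in> gwords X \<Longrightarrow> x \<in> X \<Longrightarrow>
    (u @ [(x, e), (x, \<not> e)] @ v, u @ v) \<in> pres_cong X Rel"
| rel: "u \<in> gwords X \<Longrightarrow> v \<in> gwords X \<Longrightarrow> l \<in> gwords X \<Longrightarrow> r \<in> gwords X \<Longrightarrow> (l, r) \<in> Rel \<Longrightarrow>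
    (u @ l @ v, u @ r @ v) \<in> pres_cong X Rel"

definition presented_group :: "'a set \<Rightarrow> ('a gword \<times> 'a gword) set \<Rightarrow> 'a gword set monoid"
  where "presented_group X Rel =
    \<lparr>carrier = gwords X // pres_cong X Rel,
     mult = (\<lambda>A B. \<Union>u\<in>A. \<Union>v\<in>B. pres_cong X Rel `` {u @ v}),
     one = pres_cong X Rel `` {[]}\<rparr>"

definition presented_gen :: "'a set \<Rightarrow> ('a gword \<times> 'a gword) set \<Rightarrow> 'a \<Rightarrow> 'a gword set"
  where "presented_gen X Rel x = pres_cong X Rel `` {[(x, True)]}"

lemma pres_cong_gwords:
  assumes "(v, w) \<in> pres_cong X Rel"
  shows "v \<in> gwords X \<and> w \<in> gwords X"
  using assms by induction auto

lemma equiv_pres_cong: "equiv (gwords X) (pres_cong X Rel)"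
proof (rule equivI)
  show "pres_cong X Rel \<subseteq> gwords X \<times> gwords X"
    by (auto dest: pres_cong_gwords simp del: in_lists_conv_set)
  show "refl_on (gwords X) (pres_cong X Rel)"
    by (rule refl_onI) (rule pres_cong.refl)
  show "sym (pres_cong X Rel)"
    by (rule symI) (rule pres_cong.sym)
  show "trans (pres_cong X Rel)"
    by (rule transI) (rule pres_cong.trans)
qed

lemma pres_cong_ctxt:
  assumes "(v, w) \<in> pres_cong X Rel" "a \<in> gwords X" "b \<in> gwords X"
  shows "(a @ v @ b, a @ w @ b) \<in> pres_cong X Rel"
  using assms
proof induction
  case (refl w)
  then show ?case by (auto intro!: pres_cong.refl)
next
  case (sym v w)
  show ?case by (rule pres_cong.sym[OF sym.IH]) (fact sym.prems)+
next
  case (trans u v w)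
  show ?case by (rule pres_cong.trans[OF trans.IH]) (fact trans.prems)+
next
  case (cancel u v x e)
  have "((a @ u) @ [(x, e), (x, \<not> e)] @ (v @ b), (a @ u) @ (v @ b)) \<in> pres_cong X Rel"
    by (rule pres_cong.cancel) (use cancel in auto)
  then show ?case by simp
next
  case (rel u v l r)
  have "((a @ u) @ l @ (v @ b), (a @ u) @ r @ (v @ b)) \<in> pres_cong X Rel"
    by (rule pres_cong.rel) (use rel in auto)
  then show ?case by simp
qed

lemma pres_cong_append:
  assumes "(v, v') \<in> pres_cong X Rel" "(w, w') \<in> pres_cong X Rel"
  shows "(v @ w, v' @ w') \<in> pres_cong X Rel"
proof -
  have "(v @ w, v' @ w) \<in> pres_cong X Rel"
    using pres_cong_ctxt[OF assms(1), of "[]" w] pres_cong_gwords[OF assms(2)] by simp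
  moreover have "(v' @ w, v' @ w') \<in> pres_cong X Rel"
    using pres_cong_ctxt[OF assms(2), of v' "[]"] pres_cong_gwords[OF assms(1)] by simp
  ultimately show ?thesis by (rule pres_cong.trans)
qed

lemma presented_group_mult:
  assumes "v \<in> gwords X" "w \<in> gwords X"
  shows "pres_cong X Rel `` {v} \<otimes>\<^bsub>presented_group X Rel\<^esub> pres_cong X Rel `` {w}
    = pres_cong X Rel `` {v @ w}"
proof -
  have "congruent2 (pres_cong X Rel) (pres_cong X Rel) (\<lambda>u v. pres_cong X Rel `` {u @ v})"
    by (intro congruent2I' equiv_class_eq[OF equiv_pres_cong] pres_cong_append)
  from UN_equiv_class2[OF equiv_pres_cong equiv_pres_cong this assms]
  show ?thesis by (simp add: presented_group_def)
qed

lemma presented_group_carrierE: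
  assumes "A \<in> carrier (presented_group X Rel)"
  obtains w where "w \<in> gwords X" "A = pres_cong X Rel `` {w}"
  using assms unfolding presented_group_def by (auto simp: quotient_def)

lemma presented_group_carrierI:
  "w \<in> gwords X \<Longrightarrow> pres_cong X Rel `` {w} \<in> carrier (presented_group X Rel)"
  by (simp add: presented_group_def quotientI)

lemma presented_group_one: "\<one>\<^bsub>presented_group X Rel\<^esub> = pres_cong X Rel `` {[]}"
  by (simp add: presented_group_def)

lemma pres_cong_inverse:
  assumes "w \<in> gwords X"
  shows "(rev (map (\<lambda>(x, e). (x, \<not> e)) w) @ w, []) \<in> pres_cong X Rel"
  using assms
proof (induction w)
  case Nil
  show ?case using pres_cong.refl[of "[]"] by simp
next
  case (Cons p w)
  obtain x e where p: "p = (x, e)" by (cases p)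
  let ?i = "rev (map (\<lambda>(x, e). (x, \<not> e)) w)"
  have w: "w \<in> gwords X" "?i \<in> gwords X" and x: "x \<in> X"
    using Cons p by (auto simp: in_lists_conv_set)
  have "(?i @ [(x, \<not> e), (x, \<not> \<not> e)] @ w, ?i @ w) \<in> pres_cong X Rel"
    by (rule pres_cong.cancel) (use w x in auto)
  then show ?case
    using pres_cong.trans[OF _ Cons.IH] p by simp
qed

theorem group_presented_group: "group (presented_group X Rel)"
proof (rule groupI)
  let ?G = "presented_group X Rel"
  show "A \<otimes>\<^bsub>?G\<^esub> B \<in> carrier ?G" if A: "A \<in> carrier ?G" and B: "B \<in> carrier ?G" for A B
  proof -
    obtain v w where "v \<in> gwords X" "A = pres_cong X Rel `` {v}"
      and "w \<in> gwords X" "B = pres_cong X Rel `` {w}"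
      using A B by (metis presented_group_carrierE)
    then show ?thesis
      using presented_group_carrierI[of "v @ w" X Rel] by (simp add: presented_group_mult)
  qed
  show "\<one>\<^bsub>?G\<^esub> \<in> carrier ?G"
    unfolding presented_group_one by (rule presented_group_carrierI) simp
  show "A \<otimes>\<^bsub>?G\<^esub> B \<otimes>\<^bsub>?G\<^esub> C = A \<otimes>\<^bsub>?G\<^esub> (B \<otimes>\<^bsub>?G\<^esub> C)"
    if A: "A \<in> carrier ?G" and B: "B \<in> carrier ?G" and C: "C \<in> carrier ?G" for A B C
  proof -
    obtain u v w where "u \<in> gwords X" "A = pres_cong X Rel `` {u}"
      and "v \<in> gwords X" "B = pres_cong X Rel `` {v}"
      and "w \<in> gwords X" "C = pres_cong X Rel `` {w}"
      using A B C by (metis presented_group_carrierE)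
    then show ?thesis by (simp add: presented_group_mult)
  qed
  show "\<one>\<^bsub>?G\<^esub> \<otimes>\<^bsub>?G\<^esub> A = A" if A: "A \<in> carrier ?G" for A
  proof -
    obtain w where "w \<in> gwords X" "A = pres_cong X Rel `` {w}"
      using A by (rule presented_group_carrierE)
    then show ?thesis
      using presented_group_mult[of "[]" X w Rel] by (simp add: presented_group_one)
  qed
  show "\<exists>B\<in>carrier ?G. B \<otimes>\<^bsub>?G\<^esub> A = \<one>\<^bsub>?G\<^esub>" if A: "A \<in> carrier ?G" for A
  proof -
    obtain w where w: "w \<in> gwords X" "A = pres_cong X Rel `` {w}"
      using A by (rule presented_group_carrierE)
    let ?i = "rev (map (\<lambda>(x, e). (x, \<not> e)) w)"
    have i: "?i \<in> gwords X" using w(1) by (auto simp: in_lists_conv_set)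
    have "pres_cong X Rel `` {?i} \<otimes>\<^bsub>?G\<^esub> A = \<one>\<^bsub>?G\<^esub>"
      unfolding w(2) presented_group_mult[OF i w(1)] presented_group_one
      by (intro equiv_class_eq[OF equiv_pres_cong] pres_cong_inverse w(1))
    then show ?thesis using presented_group_carrierI[OF i] by blast
  qed
qed


section \<open>The structure group and the derived structure group\<close>

definition str_rels :: "'a set \<Rightarrow> 'a pair_map \<Rightarrow> ('a gword \<times> 'a gword) set"
  where "str_rels X R =
    {([(x, True), (y, True)], [(ybe_alpha R x y, True), (ybe_beta R y x, True)]) | x y.
      x \<in> X \<and> y \<in> X}"

definition der_rels :: "'a set \<Rightarrow> 'a pair_map \<Rightarrow> ('a gword \<times> 'a gword) set"
  where "der_rels X R =
    {([(x, True), (y, True)],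
      [(y, True), (ybe_alpha R y (ybe_beta R (inv_into X (ybe_alpha R x) y) x), True)]) | x y.
      x \<in> X \<and> y \<in> X}"

definition str_group :: "'a set \<Rightarrow> 'a pair_map \<Rightarrow> 'a gword set monoid"
  where "str_group X R = presented_group X (str_rels X R)"

definition der_group :: "'a set \<Rightarrow> 'a pair_map \<Rightarrow> 'a gword set monoid"
  where "der_group X R = presented_group X (der_rels X R)"

text \<open>The natural maps from \<open>X\<close> to the two groups.\<close>

definition str_gen :: "'a set \<Rightarrow> 'a pair_map \<Rightarrow> 'a \<Rightarrow> 'a gword set"
  where "str_gen X R = presented_gen X (str_rels X R)"

definition der_gen :: "'a set \<Rightarrow> 'a pair_map \<Rightarrow> 'a \<Rightarrow> 'a gword set"
  where "der_gen X R = presented_gen X (der_rels X R)"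

definition ybe_injective :: "'a set \<Rightarrow> 'a pair_map \<Rightarrow> bool"
  where "ybe_injective X R \<longleftrightarrow> inj_on (str_gen X R) X"


section \<open>Affine actions\<close>

definition AffGroup :: "('c, 'm) monoid_scheme \<Rightarrow> (('c \<Rightarrow> 'c) \<times> 'c) monoid"
  where "AffGroup A =
    \<lparr>carrier = auto A \<times> carrier A,
     mult = (\<lambda>(S, a) (T, b). (S \<otimes>\<^bsub>AutoGroup A\<^esub> T, a \<otimes>\<^bsub>A\<^esub> S b)),
     one = (\<one>\<^bsub>AutoGroup A\<^esub>, \<one>\<^bsub>A\<^esub>)\<rparr>"

definition aff_apply :: "('c, 'm) monoid_scheme \<Rightarrow> ('c \<Rightarrow> 'c) \<times> 'c \<Rightarrow> 'c \<Rightarrow> 'c"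
  where "aff_apply A = (\<lambda>(S, a) b. a \<otimes>\<^bsub>A\<^esub> S b)"

definition affine_action ::
    "('g, 'm) monoid_scheme \<Rightarrow> ('c, 'n) monoid_scheme \<Rightarrow> ('g \<Rightarrow> ('c \<Rightarrow> 'c) \<times> 'c) \<Rightarrow> bool"
  where "affine_action G A \<rho> \<longleftrightarrow> \<rho> \<in> hom G (AffGroup A)"

definition affine_conjugate ::
    "('g, 'm) monoid_scheme \<Rightarrow>
     ('c, 'n) monoid_scheme \<Rightarrow> ('g \<Rightarrow> ('c \<Rightarrow> 'c) \<times> 'c) \<Rightarrow>
     ('d, 'p) monoid_scheme \<Rightarrow> ('g \<Rightarrow> ('d \<Rightarrow> 'd) \<times> 'd) \<Rightarrow> bool"
  where "affine_conjugate G A1 \<rho>1 A2 \<rho>2 \<longleftrightarrow>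
    affine_action G A1 \<rho>1 \<and> affine_action G A2 \<rho>2 \<and>
    (\<exists>\<phi> \<in> iso A1 A2. \<forall>g \<in> carrier G. \<forall>a \<in> carrier A1.
      \<phi> (aff_apply A1 (\<rho>1 g) a) = aff_apply A2 (\<rho>2 g) (\<phi> a))"


section \<open>The affine action associated to a solution\<close>

text \<open>The objects below are determined by their values on generators. Existence and uniqueness
  hold for every solution; membership in \<open>extensional\<close> (implicit in \<open>auto\<close>) fixes the
  irrelevant values outside the carriers, which the definite descriptions need.\<close>

text \<open>The left action of \<open>G\<^sub>X\<close> on \<open>X\<close> extending \<open>x \<mapsto> \<alpha>\<^sub>x\<close>.\<close>

definition str_action :: "'a set \<Rightarrow> 'a pair_map \<Rightarrow> 'a gword set \<Rightarrow> 'a \<Rightarrow> 'a"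
  where "str_action X R =
    (THE act. act \<in> hom (str_group X R) (BijGroup X) \<and>
      act \<in> extensional (carrier (str_group X R)) \<and>
      (\<forall>x\<in>X. \<forall>y\<in>X. act (str_gen X R x) y = ybe_alpha R x y))"

definition assoc_alpha :: "'a set \<Rightarrow> 'a pair_map \<Rightarrow> 'a gword set \<Rightarrow> 'a gword set \<Rightarrow> 'a gword set"
  where "assoc_alpha X R g =
    (THE f. f \<in> auto (der_group X R) \<and>
      (\<forall>y\<in>X. f (der_gen X R y) = der_gen X R (str_action X R g y)))"

definition assoc_cocycle :: "'a set \<Rightarrow> 'a pair_map \<Rightarrow> 'a gword set \<Rightarrow> 'a gword set"
  where "assoc_cocycle X R =
    (THE b. b \<in> carrier (str_group X R) \<rightarrow>\<^sub>E carrier (der_group X R) \<and>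
      (\<forall>g \<in> carrier (str_group X R). \<forall>h \<in> carrier (str_group X R).
        b (g \<otimes>\<^bsub>str_group X R\<^esub> h) = b g \<otimes>\<^bsub>der_group X R\<^esub> assoc_alpha X R g (b h)) \<and>
      (\<forall>x\<in>X. b (str_gen X R x) = der_gen X R x))"

definition assoc_affine_action ::
    "'a set \<Rightarrow> 'a pair_map \<Rightarrow> 'a gword set \<Rightarrow> ('a gword set \<Rightarrow> 'a gword set) \<times> 'a gword set"
  where "assoc_affine_action X R g = (assoc_alpha X R g, assoc_cocycle X R g)"

end

theory Submission
  imports Defs
begin

text \<open>An isomorphism of solutions is an equivariant bijection of all the data entering the
  definition of the affine actions, hence conjugates them. Conversely, evaluating the conjugacy
  \<open>\<psi>\<close> at the neutral element gives \<open>\<psi> \<circ> b\<^sup>X = b\<^sup>Y \<circ> \<phi>\<close>, so \<open>\<phi>\<close> and \<open>\<psi>\<close> restrict to the same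
  bijection \<open>h : X \<rightarrow> Y\<close>. Comparing linear parts, \<open>h\<close> intertwines the maps \<open>\<alpha>\<close> once \<open>Y\<close> is known to
  embed into \<open>A\<^sub>Y\<close>, and cancellation in \<open>x y = \<alpha>\<^sub>x(y) \<beta>\<^sub>y(x)\<close> in the structure group gives the maps
  \<open>\<beta>\<close>. That \<open>X\<close> embeds into \<open>A\<^sub>X\<close> whenever it embeds into \<open>G\<^sub>X\<close> follows by transporting right
  multiplication by the generators along the cocycle: \<open>T\<^sub>x(g) = g \<alpha>\<^sub>g\<^sup>-\<^sup>1(x)\<close> are permutations of \<open>G\<^sub>X\<close>
  satisfying the relations of \<open>A\<^sub>X\<close>, and \<open>T\<^sub>x(1) = x\<close>.\<close>

section \<open>Groups given by generators and relations\<close>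

lemma presented_gen_closed: "x \<in> X \<Longrightarrow> presented_gen X Rel x \<in> carrier (presented_group X Rel)"
  unfolding presented_gen_def by (intro presented_group_carrierI) simp

text \<open>The cancellation rule with first sign \<open>False\<close> gives a left inverse. This
  identifies negative letters with group-theoretic inverses of generators.\<close>

lemma presented_gen_inv:
  assumes "x \<in> X"
  shows "inv\<^bsub>presented_group X Rel\<^esub> presented_gen X Rel x = pres_cong X Rel `` {[(x, False)]}"
proof (rule group.inv_equality[OF group_presented_group])
  have "([(x, False), (x, True)], []) \<in> pres_cong X Rel"
    using pres_cong.cancel[of "[]" X "[]" x False Rel] assms by simp
  then show "pres_cong X Rel `` {[(x, False)]} \<otimes>\<^bsub>presented_group X Rel\<^esub> presented_gen X Rel x
      = \<one>\<^bsub>presented_group X Rel\<^esub>"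
    using assms unfolding presented_gen_def
    by (simp add: presented_group_mult presented_group_one equiv_class_eq[OF equiv_pres_cong])
qed (use assms in \<open>auto intro!: presented_gen_closed presented_group_carrierI\<close>)

lemma presented_group_rel:
  assumes "(l, r) \<in> Rel" "l \<in> gwords X" "r \<in> gwords X"
  shows "pres_cong X Rel `` {l} = pres_cong X Rel `` {r}"
  using pres_cong.rel[of "[]" X "[]" l r Rel] assms
  by (simp add: equiv_class_eq[OF equiv_pres_cong])

text \<open>A class is the product of the classes of its letters, and each letter is a generator or
  the inverse of one; so induction on a representing word suffices.\<close>

lemma presented_group_induct [consumes 1, case_names one gen mult inv]:
  assumes A: "A \<in> carrier (presented_group X Rel)"
    and one: "P \<one>\<^bsub>presented_group X Rel\<^esub>"
    and gen: "\<And>x. x \<in> X \<Longrightarrow> P (presented_gen X Rel x)"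
    and mult: "\<And>A B. A \<in> carrier (presented_group X Rel) \<Longrightarrow>
      B \<in> carrier (presented_group X Rel) \<Longrightarrow> P A \<Longrightarrow> P B \<Longrightarrow> P (A \<otimes>\<^bsub>presented_group X Rel\<^esub> B)"
    and inv: "\<And>A. A \<in> carrier (presented_group X Rel) \<Longrightarrow> P A \<Longrightarrow> P (inv\<^bsub>presented_group X Rel\<^esub> A)"
  shows "P A"
proof -
  obtain w where w: "w \<in> gwords X" and A: "A = pres_cong X Rel `` {w}"
    using A by (rule presented_group_carrierE)
  from w have "P (pres_cong X Rel `` {w})"
  proof (induction w)
    case Nil
    then show ?case using one by (simp add: presented_group_one)
  next
    case (Cons p w)
    obtain x e where p: "p = (x, e)" by (cases p)
    have x: "x \<in> X" and w: "w \<in> gwords X" using Cons.hyps p by auto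
    have "P (pres_cong X Rel `` {[p]})"
      using gen[OF x] inv[OF presented_gen_closed[OF x] gen[OF x]] p
      by (cases e) (simp_all add: presented_gen_inv[OF x], simp add: presented_gen_def)
    moreover have "[p] \<in> gwords X" using Cons.hyps by simp
    ultimately have "P (pres_cong X Rel `` {[p]} \<otimes>\<^bsub>presented_group X Rel\<^esub> pres_cong X Rel `` {w})"
      using Cons.IH w by (intro mult presented_group_carrierI)
    then show ?case using presented_group_mult[OF \<open>[p] \<in> gwords X\<close> w] by simp
  qed
  then show ?thesis using A by simp
qed

text \<open>The uniqueness half of the universal property; it is the source of uniqueness for all
  the definite descriptions below.\<close>

lemma presented_group_hom_eq:
  assumes F: "F \<in> hom (presented_group X Rel) H" and F': "F' \<in> hom (presented_group X Rel) H"
    and H: "group H"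
    and gen: "\<And>x. x \<in> X \<Longrightarrow> F (presented_gen X Rel x) = F' (presented_gen X Rel x)"
    and A: "A \<in> carrier (presented_group X Rel)"
  shows "F A = F' A"
proof -
  interpret F: group_hom "presented_group X Rel" H F
    using F H by (simp add: group_hom_def group_hom_axioms_def group_presented_group)
  interpret F': group_hom "presented_group X Rel" H F'
    using F' H by (simp add: group_hom_def group_hom_axioms_def group_presented_group)
  from A show ?thesis
    by (induction rule: presented_group_induct) (simp_all add: gen)
qed

section \<open>The universal property of a presentation\<close>

definition word_eval :: "('g, 'm) monoid_scheme \<Rightarrow> ('a \<Rightarrow> 'g) \<Rightarrow> 'a gword \<Rightarrow> 'g"
  where "word_eval H f w =
    foldr (\<lambda>(x, e) a. (if e then f x else inv\<^bsub>H\<^esub> f x) \<otimes>\<^bsub>H\<^esub> a) w \<one>\<^bsub>H\<^esub>"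

lemma word_eval_Nil [simp]: "word_eval H f [] = \<one>\<^bsub>H\<^esub>"
  and word_eval_Cons [simp]: "word_eval H f ((x, e) # w) =
    (if e then f x else inv\<^bsub>H\<^esub> f x) \<otimes>\<^bsub>H\<^esub> word_eval H f w"
  by (simp_all add: word_eval_def)

context group
begin

lemma word_eval_closed:
  "w \<in> gwords X \<Longrightarrow> f \<in> X \<rightarrow> carrier G \<Longrightarrow> word_eval G f w \<in> carrier G"
  by (induction w) (auto simp: Pi_iff)

lemma word_eval_append:
  "v \<in> gwords X \<Longrightarrow> w \<in> gwords X \<Longrightarrow> f \<in> X \<rightarrow> carrier G \<Longrightarrow>
    word_eval G f (v @ w) = word_eval G f v \<otimes> word_eval G f w"
proof (induction v)
  case Nil
  then show ?case using word_eval_closed[of w X f] by simp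
next
  case (Cons p v)
  then show ?case
    using word_eval_closed[of v X f] word_eval_closed[of w X f]
    by (cases p) (auto simp: m_assoc Pi_iff)
qed

text \<open>Evaluation is multiplicative on concatenations, so only the middle segment of an
  elementary step matters: it cancels, or it is one side of a relation.\<close>

lemma word_eval_cong:
  assumes "(v, w) \<in> pres_cong X Rel" "f \<in> X \<rightarrow> carrier G"
    and rel: "\<And>l r. (l, r) \<in> Rel \<Longrightarrow> l \<in> gwords X \<Longrightarrow> r \<in> gwords X \<Longrightarrow>
      word_eval G f l = word_eval G f r"
  shows "word_eval G f v = word_eval G f w"
  using assms(1)
proof induction
  case (cancel u v x e)
  have x: "f x \<in> carrier G" using cancel assms(2) by auto
  have "word_eval G f ((x, e) # (x, \<not> e) # v) = word_eval G f v"
    using x word_eval_closed[OF cancel(2) assms(2)]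
    by (cases e) (simp_all add: m_assoc[symmetric])
  then show ?case
    using cancel assms(2) word_eval_append[of u X "(x, e) # (x, \<not> e) # v" f]
    by (simp add: word_eval_append)
next
  case (rel u v l r)
  then show ?case
    using assms(3)[OF rel(5,3,4)] assms(2) by (simp add: word_eval_append)
qed auto

lemma presented_group_hom_exists:
  assumes f: "f \<in> X \<rightarrow> carrier G"
    and rel: "\<And>l r. (l, r) \<in> Rel \<Longrightarrow> l \<in> gwords X \<Longrightarrow> r \<in> gwords X \<Longrightarrow>
      word_eval G f l = word_eval G f r"
  obtains F where "F \<in> hom (presented_group X Rel) G"
    and "\<And>x. x \<in> X \<Longrightarrow> F (presented_gen X Rel x) = f x"
proof -
  \<comment> \<open>The chosen representative is irrelevant: by \<open>word_eval_cong\<close> every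
    word in the class has the same value.\<close>
  define F where "F A = word_eval G f (SOME w. w \<in> A)" for A
  have F: "F (pres_cong X Rel `` {w}) = word_eval G f w" if "w \<in> gwords X" for w
  proof -
    have "w \<in> pres_cong X Rel `` {w}" using that by (simp add: pres_cong.refl)
    then have "(SOME v. v \<in> pres_cong X Rel `` {w}) \<in> pres_cong X Rel `` {w}" by (rule someI)
    then show ?thesis using word_eval_cong[OF _ f rel] unfolding F_def by auto
  qed
  have "F \<in> hom (presented_group X Rel) G"
  proof (rule homI)
    fix A assume "A \<in> carrier (presented_group X Rel)"
    then show "F A \<in> carrier G"
      by (metis presented_group_carrierE F word_eval_closed f)
  next
    fix A B assume "A \<in> carrier (presented_group X Rel)" "B \<in> carrier (presented_group X Rel)"
    then obtain v w where vw: "v \<in> gwords X" "w \<in> gwords X"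
      and "A = pres_cong X Rel `` {v}" "B = pres_cong X Rel `` {w}"
      by (metis presented_group_carrierE)
    then show "F (A \<otimes>\<^bsub>presented_group X Rel\<^esub> B) = F A \<otimes> F B"
      by (simp add: presented_group_mult F word_eval_append[OF _ _ f])
  qed
  moreover have "F (presented_gen X Rel x) = f x" if "x \<in> X" for x
    using F[of "[(x, True)]"] that f by (auto simp: presented_gen_def Pi_iff)
  ultimately show ?thesis by (rule that)
qed

end

text \<open>Both composites fix the generators, so by uniqueness of homomorphisms they are
  identities on the carriers.\<close>

lemma presented_group_isoI:
  assumes h: "bij_betw h X Y"
    and F: "F \<in> hom (presented_group X Rel) (presented_group Y Rel')"
      "\<And>x. x \<in> X \<Longrightarrow> F (presented_gen X Rel x) = presented_gen Y Rel' (h x)"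
    and F': "F' \<in> hom (presented_group Y Rel') (presented_group X Rel)"
      "\<And>y. y \<in> Y \<Longrightarrow> F' (presented_gen Y Rel' y) = presented_gen X Rel (inv_into X h y)"
  shows "F \<in> iso (presented_group X Rel) (presented_group Y Rel')"
proof -
  have hY: "h x \<in> Y" if "x \<in> X" for x using h that by (rule bij_betw_apply)
  have hX: "inv_into X h y \<in> X" if "y \<in> Y" for y
    using bij_betw_inv_into[OF h] that by (rule bij_betw_apply)
  have "F' (F A) = A" if "A \<in> carrier (presented_group X Rel)" for A
    using presented_group_hom_eq[OF hom_compose[OF F(1) F'(1)] _ group_presented_group _ that, of id]
    by (simp add: F F' hY bij_betw_inv_into_left[OF h] hom_def)
  moreover have "F (F' A) = A" if "A \<in> carrier (presented_group Y Rel')" for A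
    using presented_group_hom_eq[OF hom_compose[OF F'(1) F(1)] _ group_presented_group _ that, of id]
    by (simp add: F F' hX bij_betw_inv_into_right[OF h] hom_def)
  ultimately show ?thesis
    using F(1) F'(1) unfolding iso_def
    by (auto intro!: bij_betw_byWitness[where f' = F'] simp: hom_def)
qed


section \<open>Bijections and the affine group\<close>

lemma BijGroup_mult_apply:
  "f \<in> Bij S \<Longrightarrow> g \<in> Bij S \<Longrightarrow> s \<in> S \<Longrightarrow> (f \<otimes>\<^bsub>BijGroup S\<^esub> g) s = f (g s)"
  by (simp add: BijGroup_def compose_eq)

lemma carrier_BijGroup: "carrier (BijGroup S) = Bij S"
  by (simp add: BijGroup_def)

lemma (in group) AutoGroup_mult_apply:
  assumes "S \<in> auto G" "T \<in> auto G" "a \<in> carrier G"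
  shows "(S \<otimes>\<^bsub>AutoGroup G\<^esub> T) a = S (T a)"
  using assms by (simp add: AutoGroup_def BijGroup_def auto_def compose_eq)

lemma carrier_AutoGroup [simp]: "carrier (AutoGroup A) = auto A"
  by (simp add: AutoGroup_def)

lemma AffGroup_simps [simp]:
  "carrier (AffGroup A) = auto A \<times> carrier A"
  "(S, a) \<otimes>\<^bsub>AffGroup A\<^esub> (T, b) = (S \<otimes>\<^bsub>AutoGroup A\<^esub> T, a \<otimes>\<^bsub>A\<^esub> S b)"
  "\<one>\<^bsub>AffGroup A\<^esub> = (\<one>\<^bsub>AutoGroup A\<^esub>, \<one>\<^bsub>A\<^esub>)"
  by (simp_all add: AffGroup_def)

lemma auto_hom: "f \<in> auto A \<Longrightarrow> f \<in> hom A A"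
  by (simp add: auto_def)

lemma (in group) group_AffGroup: "group (AffGroup G)"
proof -
  interpret Aut: group "AutoGroup G" by (rule AutoGroup)
  have closed: "S a \<in> carrier G" if "S \<in> auto G" "a \<in> carrier G" for S a
    using auto_hom[OF that(1)] that(2) by (rule hom_in_carrier)
  have mult: "S (a \<otimes> b) = S a \<otimes> S b" if "S \<in> auto G" "a \<in> carrier G" "b \<in> carrier G" for S a b
    using auto_hom[OF that(1)] that(2,3) by (rule hom_mult)
  have one: "\<one>\<^bsub>AutoGroup G\<^esub> a = a" if "a \<in> carrier G" for a
    using that by (simp add: AutoGroup_def BijGroup_def)
  have Aut: "S \<otimes>\<^bsub>AutoGroup G\<^esub> T \<in> auto G" "inv\<^bsub>AutoGroup G\<^esub> S \<in> auto G"
    if "S \<in> auto G" "T \<in> auto G" for S T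
    using that Aut.m_closed[of S T] Aut.inv_closed[of S] by simp_all
  show ?thesis
  proof (rule groupI)
    fix p assume p: "p \<in> carrier (AffGroup G)"
    obtain S a where Sa: "p = (S, a)" "S \<in> auto G" "a \<in> carrier G" using p by auto
    let ?S = "inv\<^bsub>AutoGroup G\<^esub> S"
    have "?S a \<in> carrier G" using Sa Aut closed by blast
    then show "\<exists>q\<in>carrier (AffGroup G). q \<otimes>\<^bsub>AffGroup G\<^esub> p = \<one>\<^bsub>AffGroup G\<^esub>"
      \<comment> \<open>The translation part of the left inverse must cancel \<open>?S a\<close> in
        the semidirect product.\<close>
      using Sa Aut Aut.l_inv[of S] by (intro bexI[of _ "(?S, inv (?S a))"]) auto
  next
    fix p q r assume "p \<in> carrier (AffGroup G)" "q \<in> carrier (AffGroup G)" "r \<in> carrier (AffGroup G)"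
    then show "p \<otimes>\<^bsub>AffGroup G\<^esub> q \<otimes>\<^bsub>AffGroup G\<^esub> r = p \<otimes>\<^bsub>AffGroup G\<^esub> (q \<otimes>\<^bsub>AffGroup G\<^esub> r)"
      by (auto simp: Aut.m_assoc m_assoc AutoGroup_mult_apply closed mult)
  next
    show "\<one>\<^bsub>AffGroup G\<^esub> \<in> carrier (AffGroup G)" using Aut.one_closed by simp
  qed (use Aut closed one Aut.l_one in auto)
qed


section \<open>The groups and actions of a solution\<close>

locale ybe =
  fixes X :: "'a set" and R :: "'a pair_map"
  assumes sol: "ybe_solution X R"
begin

abbreviation \<alpha> :: "'a \<Rightarrow> 'a \<Rightarrow> 'a" where "\<alpha> \<equiv> ybe_alpha R"
abbreviation \<beta> :: "'a \<Rightarrow> 'a \<Rightarrow> 'a" where "\<beta> \<equiv> ybe_beta R"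
abbreviation G where "G \<equiv> str_group X R"
abbreviation A where "A \<equiv> der_group X R"
abbreviation \<gamma> where "\<gamma> \<equiv> str_gen X R"
abbreviation \<delta> where "\<delta> \<equiv> der_gen X R"

text \<open>The self-distributive operation in terms of which the relations of the derived group
  read \<open>x \<bullet> y = y \<bullet> \<sigma> y x\<close>.\<close>

definition \<sigma> :: "'a \<Rightarrow> 'a \<Rightarrow> 'a"
  where "\<sigma> y x = \<alpha> y (\<beta> (inv_into X (\<alpha> x) y) x)"

section \<open>Non-degeneracy and the Yang-Baxter identities for \<alpha>, \<beta> and
  \<sigma>\<close>

lemma bij_alpha: "x \<in> X \<Longrightarrow> bij_betw (\<alpha> x) X X"
  and bij_beta: "x \<in> X \<Longrightarrow> bij_betw (\<beta> x) X X"
  using sol by (auto simp: ybe_solution_def)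

lemma alpha_closed [simp]: "x \<in> X \<Longrightarrow> y \<in> X \<Longrightarrow> \<alpha> x y \<in> X"
  and beta_closed [simp]: "x \<in> X \<Longrightarrow> y \<in> X \<Longrightarrow> \<beta> x y \<in> X"
  using bij_betw_apply[OF bij_alpha] bij_betw_apply[OF bij_beta] by blast+

text \<open>These are the first and middle components of the Yang-Baxter equation at
  \<open>(x, y, z)\<close>.\<close>

lemma
  assumes "x \<in> X" "y \<in> X" "z \<in> X"
  shows alpha_alpha: "\<alpha> x (\<alpha> y z) = \<alpha> (\<alpha> x y) (\<alpha> (\<beta> y x) z)"
    and beta_alpha: "\<beta> (\<alpha> (\<beta> y x) z) (\<alpha> x y) = \<alpha> (\<beta> (\<alpha> y z) x) (\<beta> z y)"
proof -
  have R: "R p = (\<alpha> (fst p) (snd p), \<beta> (snd p) (fst p))" for p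
    by (simp add: ybe_alpha_def ybe_beta_def)
  have "(R_times_id R \<circ> id_times_R R \<circ> R_times_id R) (x, y, z) =
      (id_times_R R \<circ> R_times_id R \<circ> id_times_R R) (x, y, z)"
    using sol assms unfolding ybe_solution_def by blast
  then have "(\<alpha> (\<alpha> x y) (\<alpha> (\<beta> y x) z), \<beta> (\<alpha> (\<beta> y x) z) (\<alpha> x y)) =
      (\<alpha> x (\<alpha> y z), \<alpha> (\<beta> (\<alpha> y z) x) (\<beta> z y))"
    by (simp add: R_times_id_def id_times_R_def R)
  then show "\<alpha> x (\<alpha> y z) = \<alpha> (\<alpha> x y) (\<alpha> (\<beta> y x) z)"
    and "\<beta> (\<alpha> (\<beta> y x) z) (\<alpha> x y) = \<alpha> (\<beta> (\<alpha> y z) x) (\<beta> z y)"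
    by simp_all
qed

text \<open>Writing the lower argument of \<sigma> as \<open>\<alpha> x y\<close> removes the
  inverse from its definition. By \<open>alpha_surjE\<close> every argument has this form, so later
  proofs about \<sigma> start with this substitution.\<close>

lemma sigma_alpha:
  assumes "x \<in> X" "y \<in> X"
  shows "\<sigma> (\<alpha> x y) x = \<alpha> (\<alpha> x y) (\<beta> y x)"
  using assms by (simp add: \<sigma>_def bij_betw_inv_into_left[OF bij_alpha])

lemma alpha_surjE:
  assumes "x \<in> X" "y \<in> X"
  obtains w where "w \<in> X" "y = \<alpha> x w"
  using bij_alpha[OF assms(1)] assms(2) by (auto simp: bij_betw_def)

lemma sigma_closed [simp]: "x \<in> X \<Longrightarrow> y \<in> X \<Longrightarrow> \<sigma> y x \<in> X"
  by (metis alpha_surjE sigma_alpha alpha_closed beta_closed)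

text \<open>With \<open>y = \<alpha> x w\<close>, both sides become
  \<open>\<alpha> z (\<alpha> y (\<beta> w x))\<close> after two uses of \<open>alpha_alpha\<close>
  and one of \<open>beta_alpha\<close>. Hence every \<open>\<alpha> z\<close> respects the relations
  of the derived group.\<close>

lemma alpha_sigma:
  assumes x: "x \<in> X" and y: "y \<in> X" and z: "z \<in> X"
  shows "\<alpha> z (\<sigma> y x) = \<sigma> (\<alpha> z y) (\<alpha> z x)"
proof -
  obtain w where w: "w \<in> X" "y = \<alpha> x w" using x y by (rule alpha_surjE)
  \<comment> \<open>By \<open>alpha_alpha\<close> this element satisfies
    \<open>\<alpha> (\<alpha> z x) ?w = \<alpha> z y\<close>, so \<open>sigma_alpha\<close> applies
    to the transported pair.\<close>
  let ?w = "\<alpha> (\<beta> x z) w"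
  have "\<sigma> (\<alpha> z y) (\<alpha> z x) = \<sigma> (\<alpha> (\<alpha> z x) ?w) (\<alpha> z x)"
    using alpha_alpha[OF z x w(1)] w by simp
  also have "\<dots> = \<alpha> (\<alpha> z y) (\<beta> ?w (\<alpha> z x))"
    using sigma_alpha[of "\<alpha> z x" ?w] alpha_alpha[OF z x w(1)] w x z by simp
  also have "\<dots> = \<alpha> (\<alpha> z y) (\<alpha> (\<beta> y z) (\<beta> w x))"
    using beta_alpha[OF z x w(1)] w by simp
  also have "\<dots> = \<alpha> z (\<alpha> y (\<beta> w x))"
    using alpha_alpha[of z y "\<beta> w x"] w x y z by simp
  finally show ?thesis using sigma_alpha[OF x w(1)] w by simp
qed

section \<open>The two groups of a solution and their universal properties\<close>

lemma group_G: "group G" and group_A: "group A"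
  unfolding str_group_def der_group_def by (rule group_presented_group)+

sublocale G: group G by (rule group_G)
sublocale A: group A by (rule group_A)

lemma str_gen_closed [simp]: "x \<in> X \<Longrightarrow> \<gamma> x \<in> carrier G"
  and der_gen_closed [simp]: "x \<in> X \<Longrightarrow> \<delta> x \<in> carrier A"
  unfolding str_group_def der_group_def str_gen_def der_gen_def
  by (rule presented_gen_closed, assumption)+

lemma str_rel:
  assumes "x \<in> X" "y \<in> X"
  shows "\<gamma> x \<otimes>\<^bsub>G\<^esub> \<gamma> y = \<gamma> (\<alpha> x y) \<otimes>\<^bsub>G\<^esub> \<gamma> (\<beta> y x)"
  using assms unfolding str_group_def str_gen_def presented_gen_def
  by (simp add: presented_group_mult)
    (rule presented_group_rel, auto simp: str_rels_def)

lemma der_rel: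
  assumes "x \<in> X" "y \<in> X"
  shows "\<delta> x \<otimes>\<^bsub>A\<^esub> \<delta> y = \<delta> y \<otimes>\<^bsub>A\<^esub> \<delta> (\<sigma> y x)"
  using assms unfolding der_group_def der_gen_def presented_gen_def
  by (simp add: presented_group_mult)
    (rule presented_group_rel, use sigma_closed[OF assms] in \<open>auto simp: der_rels_def \<sigma>_def\<close>)

lemmas str_group_induct [consumes 1, case_names one gen mult inv] =
  presented_group_induct[of _ X "str_rels X R", folded str_group_def str_gen_def]

lemmas str_group_hom_eq =
  presented_group_hom_eq[of _ X "str_rels X R", folded str_group_def str_gen_def]

lemmas der_group_hom_eq =
  presented_group_hom_eq[of _ X "der_rels X R", folded der_group_def der_gen_def]

lemma str_group_hom_exists:
  assumes "group H" "f \<in> X \<rightarrow> carrier H"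
    and rel: "\<And>x y. x \<in> X \<Longrightarrow> y \<in> X \<Longrightarrow> f x \<otimes>\<^bsub>H\<^esub> f y = f (\<alpha> x y) \<otimes>\<^bsub>H\<^esub> f (\<beta> y x)"
  obtains F where "F \<in> hom G H" "\<And>x. x \<in> X \<Longrightarrow> F (\<gamma> x) = f x"
proof -
  interpret H: group H by fact
  show ?thesis
  proof (rule H.presented_group_hom_exists[of f X "str_rels X R"])
    fix l r assume "(l, r) \<in> str_rels X R"
    then show "word_eval H f l = word_eval H f r"
      using assms(2) by (auto simp: str_rels_def Pi_iff intro!: rel)
  qed (use assms(2) that in \<open>simp_all add: str_group_def str_gen_def\<close>)
qed

lemma der_group_hom_exists:
  assumes "group H" "f \<in> X \<rightarrow> carrier H"
    and rel: "\<And>x y. x \<in> X \<Longrightarrow> y \<in> X \<Longrightarrow> f x \<otimes>\<^bsub>H\<^esub> f y = f y \<otimes>\<^bsub>H\<^esub> f (\<sigma> y x)"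
  obtains F where "F \<in> hom A H" "\<And>x. x \<in> X \<Longrightarrow> F (\<delta> x) = f x"
proof -
  interpret H: group H by fact
  show ?thesis
  proof (rule H.presented_group_hom_exists[of f X "der_rels X R"])
    fix l r assume "(l, r) \<in> der_rels X R"
    then show "word_eval H f l = word_eval H f r"
      using assms(2) sigma_closed[unfolded \<sigma>_def]
      by (auto simp: der_rels_def Pi_iff intro!: rel[unfolded \<sigma>_def])
  qed (use assms(2) that in \<open>simp_all add: der_group_def der_gen_def\<close>)
qed


subsection \<open>The action on generators\<close>

abbreviation act where "act \<equiv> str_action X R"

text \<open>By \<open>alpha_alpha\<close> the permutations \<open>\<alpha> x\<close> satisfy the
  relations of \<open>G\<close>, so they extend to a homomorphism. Since it is unique among
  extensional maps, the definite description denotes it.\<close>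

lemma act_exists:
  shows act_hom: "act \<in> hom G (BijGroup X)"
    and act_gen_apply: "\<And>x y. x \<in> X \<Longrightarrow> y \<in> X \<Longrightarrow> act (\<gamma> x) y = \<alpha> x y"
proof -
  have bij: "restrict (\<alpha> x) X \<in> Bij X" if "x \<in> X" for x
    using bij_alpha[OF that] by (simp add: Bij_def cong: bij_betw_cong)
  obtain F where F: "F \<in> hom G (BijGroup X)" "\<And>x. x \<in> X \<Longrightarrow> F (\<gamma> x) = restrict (\<alpha> x) X"
  proof (rule str_group_hom_exists[OF group_BijGroup])
    show "restrict (\<alpha> x) X \<otimes>\<^bsub>BijGroup X\<^esub> restrict (\<alpha> y) X =
        restrict (\<alpha> (\<alpha> x y)) X \<otimes>\<^bsub>BijGroup X\<^esub> restrict (\<alpha> (\<beta> y x)) X"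
      if "x \<in> X" "y \<in> X" for x y
      using that alpha_alpha[of x y] by (auto simp: BijGroup_def bij compose_def fun_eq_iff)
  qed (use bij that in \<open>auto simp: carrier_BijGroup simp del: restrict_apply\<close>)
  let ?P = "\<lambda>a. a \<in> hom G (BijGroup X) \<and> a \<in> extensional (carrier G) \<and>
      (\<forall>x\<in>X. \<forall>y\<in>X. a (\<gamma> x) y = \<alpha> x y)"
  have "?P (restrict F (carrier G))"
    using F by (auto simp: hom_def)
  moreover have "a = restrict F (carrier G)" if a: "?P a" for a
  proof (rule extensionalityI)
    \<comment> \<open>The specification fixes values only on \<open>X\<close>; equality as functions
      also uses that elements of \<open>Bij X\<close> are extensional.\<close>
    have "a (\<gamma> x) = F (\<gamma> x)" if x: "x \<in> X" for x
    proof (rule extensionalityI)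
      have "a (\<gamma> x) \<in> carrier (BijGroup X)" using a x by (auto simp: hom_def)
      then show "a (\<gamma> x) \<in> extensional X" by (simp add: carrier_BijGroup Bij_imp_extensional)
    qed (use a x F in auto)
    then show "a g = restrict F (carrier G) g" if "g \<in> carrier G" for g
      using str_group_hom_eq[of a "BijGroup X" F g] a F that group_BijGroup by auto
  qed (use a in auto)
  ultimately have "?P act" unfolding str_action_def by (rule theI)
  then show "act \<in> hom G (BijGroup X)"
    and "\<And>x y. x \<in> X \<Longrightarrow> y \<in> X \<Longrightarrow> act (\<gamma> x) y = \<alpha> x y" by auto
qed

interpretation act: group_hom G "BijGroup X" act
  by (intro group_hom.intro group_hom_axioms.intro group_G group_BijGroup act_hom)

lemma act_Bij: "g \<in> carrier G \<Longrightarrow> act g \<in> Bij X"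
  using act.hom_closed by (simp add: carrier_BijGroup)

lemma act_closed [simp]: "g \<in> carrier G \<Longrightarrow> x \<in> X \<Longrightarrow> act g x \<in> X"
  using Bij_imp_funcset[OF act_Bij] by blast

lemma act_mult: "g \<in> carrier G \<Longrightarrow> h \<in> carrier G \<Longrightarrow> x \<in> X \<Longrightarrow> act (g \<otimes>\<^bsub>G\<^esub> h) x = act g (act h x)"
  by (simp add: BijGroup_mult_apply act_Bij)

lemma act_one: "x \<in> X \<Longrightarrow> act \<one>\<^bsub>G\<^esub> x = x"
  by (simp add: BijGroup_def)

lemma act_inv_left: "g \<in> carrier G \<Longrightarrow> x \<in> X \<Longrightarrow> act (inv\<^bsub>G\<^esub> g) (act g x) = x"
  and act_inv_right: "g \<in> carrier G \<Longrightarrow> x \<in> X \<Longrightarrow> act g (act (inv\<^bsub>G\<^esub> g) x) = x"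
  by (simp_all add: act_mult[symmetric] act_one del: act.hom_mult act.hom_inv act.hom_one)

text \<open>Preserving \<sigma> passes from the generators, where it is \<open>alpha_sigma\<close>,
  to products and inverses.\<close>

lemma act_sigma:
  assumes "g \<in> carrier G" "x \<in> X" "y \<in> X"
  shows "act g (\<sigma> y x) = \<sigma> (act g y) (act g x)"
  using assms
proof (induction arbitrary: x y rule: str_group_induct)
  case (inv g)
  \<comment> \<open>The induction hypothesis is used at the preimages of \<open>x\<close> and
    \<open>y\<close> under \<open>act g\<close>.\<close>
  let ?a = "act (inv\<^bsub>G\<^esub> g)"
  have cl: "?a x \<in> X" "?a y \<in> X" using inv by (simp_all del: act.hom_inv)
  have "act g (\<sigma> (?a y) (?a x)) = \<sigma> y x"
    using inv.IH[OF cl] inv.hyps inv.prems by (simp add: act_inv_right del: act.hom_inv)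
  then have "?a (\<sigma> y x) = ?a (act g (\<sigma> (?a y) (?a x)))" by (simp only:)
  also have "\<dots> = \<sigma> (?a y) (?a x)" using inv.hyps cl by (intro act_inv_left sigma_closed)
  finally show ?case .
qed (simp_all add: act_one act_gen_apply alpha_sigma act_mult
    del: act.hom_one act.hom_mult)

end


subsection \<open>Functoriality of the two groups\<close>

lemma str_group_iso_exists:
  assumes "ybe X R" "ybe Y S" and h: "bij_betw h X Y"
    and iso: "\<And>p. p \<in> X \<times> X \<Longrightarrow> S (map_prod h h p) = map_prod h h (R p)"
  obtains F where "F \<in> iso (str_group X R) (str_group Y S)"
    and "\<And>x. x \<in> X \<Longrightarrow> F (str_gen X R x) = str_gen Y S (h x)"
proof -
  interpret X: ybe X R by fact
  interpret Y: ybe Y S by fact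
  let ?h = "inv_into X h"
  have alpha: "h (X.\<alpha> x y) = Y.\<alpha> (h x) (h y)" and beta: "h (X.\<beta> y x) = Y.\<beta> (h y) (h x)"
    if "x \<in> X" "y \<in> X" for x y
    using iso[of "(x, y)"] that by (simp_all add: ybe_alpha_def ybe_beta_def prod_eq_iff)
  have hY: "h x \<in> Y" if "x \<in> X" for x using h that by (rule bij_betw_apply)
  have hX: "?h y \<in> X" if "y \<in> Y" for y
    using bij_betw_inv_into[OF h] that by (rule bij_betw_apply)
  have alpha': "?h (Y.\<alpha> x y) = X.\<alpha> (?h x) (?h y)" and beta': "?h (Y.\<beta> y x) = X.\<beta> (?h y) (?h x)"
    if "x \<in> Y" "y \<in> Y" for x y
    using that alpha[of "?h x" "?h y"] beta[of "?h x" "?h y"] hX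
      bij_betw_inv_into_left[OF h, of "X.\<alpha> (?h x) (?h y)"]
      bij_betw_inv_into_left[OF h, of "X.\<beta> (?h y) (?h x)"]
    by (simp_all add: bij_betw_inv_into_right[OF h])
  obtain F where F: "F \<in> hom X.G Y.G" "\<And>x. x \<in> X \<Longrightarrow> F (X.\<gamma> x) = Y.\<gamma> (h x)"
  proof (rule X.str_group_hom_exists[OF Y.group_G, of "\<lambda>x. Y.\<gamma> (h x)"])
    fix x y assume "x \<in> X" "y \<in> X"
    then show "Y.\<gamma> (h x) \<otimes>\<^bsub>Y.G\<^esub> Y.\<gamma> (h y) = Y.\<gamma> (h (X.\<alpha> x y)) \<otimes>\<^bsub>Y.G\<^esub> Y.\<gamma> (h (X.\<beta> y x))"
      using Y.str_rel[of "h x" "h y"] by (simp add: hY alpha beta)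
  qed (use hY that in auto)
  obtain F' where F': "F' \<in> hom Y.G X.G" "\<And>y. y \<in> Y \<Longrightarrow> F' (Y.\<gamma> y) = X.\<gamma> (?h y)"
  proof (rule Y.str_group_hom_exists[OF X.group_G, of "\<lambda>y. X.\<gamma> (?h y)"])
    fix x y assume "x \<in> Y" "y \<in> Y"
    then show "X.\<gamma> (?h x) \<otimes>\<^bsub>X.G\<^esub> X.\<gamma> (?h y) = X.\<gamma> (?h (Y.\<alpha> x y)) \<otimes>\<^bsub>X.G\<^esub> X.\<gamma> (?h (Y.\<beta> y x))"
      using X.str_rel[of "?h x" "?h y"] by (simp add: hX alpha' beta')
  qed (use hX that in auto)
  have "F \<in> iso X.G Y.G"
    using presented_group_isoI[OF h, of F _ _ F'] F F'
    by (simp add: str_group_def str_gen_def)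
  then show ?thesis using F(2) by (rule that)
qed

text \<open>The relations of the derived group involve only \<sigma>, so compatibility of
  \<open>h\<close> and of its inverse with \<sigma> is enough. This form also covers the permutation
  \<open>act g\<close> of a single solution.\<close>

lemma der_group_iso_exists:
  assumes "ybe X R" "ybe Y S" and h: "bij_betw h X Y"
    and sigma: "\<And>x y. x \<in> X \<Longrightarrow> y \<in> X \<Longrightarrow> h (ybe.\<sigma> X R y x) = ybe.\<sigma> Y S (h y) (h x)"
  obtains F where "F \<in> iso (der_group X R) (der_group Y S)"
    and "\<And>x. x \<in> X \<Longrightarrow> F (der_gen X R x) = der_gen Y S (h x)"
proof -
  interpret X: ybe X R by fact
  interpret Y: ybe Y S by fact
  let ?h = "inv_into X h"
  have hY: "h x \<in> Y" if "x \<in> X" for x using h that by (rule bij_betw_apply)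
  have hX: "?h y \<in> X" if "y \<in> Y" for y
    using bij_betw_inv_into[OF h] that by (rule bij_betw_apply)
  have sigma': "?h (Y.\<sigma> y x) = X.\<sigma> (?h y) (?h x)" if "x \<in> Y" "y \<in> Y" for x y
    using that sigma[of "?h x" "?h y"] hX
      bij_betw_inv_into_left[OF h, of "X.\<sigma> (?h y) (?h x)"]
    by (simp add: bij_betw_inv_into_right[OF h])
  obtain F where F: "F \<in> hom X.A Y.A" "\<And>x. x \<in> X \<Longrightarrow> F (X.\<delta> x) = Y.\<delta> (h x)"
  proof (rule X.der_group_hom_exists[OF Y.group_A, of "\<lambda>x. Y.\<delta> (h x)"])
    fix x y assume "x \<in> X" "y \<in> X"
    then show "Y.\<delta> (h x) \<otimes>\<^bsub>Y.A\<^esub> Y.\<delta> (h y) = Y.\<delta> (h y) \<otimes>\<^bsub>Y.A\<^esub> Y.\<delta> (h (X.\<sigma> y x))"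
      using Y.der_rel[of "h x" "h y"] by (simp add: hY sigma)
  qed (use hY that in auto)
  obtain F' where F': "F' \<in> hom Y.A X.A" "\<And>y. y \<in> Y \<Longrightarrow> F' (Y.\<delta> y) = X.\<delta> (?h y)"
  proof (rule Y.der_group_hom_exists[OF X.group_A, of "\<lambda>y. X.\<delta> (?h y)"])
    fix x y assume "x \<in> Y" "y \<in> Y"
    then show "X.\<delta> (?h x) \<otimes>\<^bsub>X.A\<^esub> X.\<delta> (?h y) = X.\<delta> (?h y) \<otimes>\<^bsub>X.A\<^esub> X.\<delta> (?h (Y.\<sigma> y x))"
      using X.der_rel[of "?h x" "?h y"] by (simp add: hX sigma')
  qed (use hX that in auto)
  have "F \<in> iso X.A Y.A"
    using presented_group_isoI[OF h, of F _ _ F'] F F'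
    by (simp add: der_group_def der_gen_def)
  then show ?thesis using F(2) by (rule that)
qed


section \<open>The associated affine action\<close>

context ybe
begin

abbreviation \<Lambda> where "\<Lambda> \<equiv> assoc_alpha X R"
abbreviation \<kappa> where "\<kappa> \<equiv> assoc_cocycle X R"

section \<open>The linear part and the cocycle\<close>

lemma auto_eqI:
  assumes "f \<in> auto A" "f' \<in> auto A" "\<And>x. x \<in> X \<Longrightarrow> f (\<delta> x) = f' (\<delta> x)"
  shows "f = f'"
proof (rule extensionalityI)
  show "f a = f' a" if "a \<in> carrier A" for a
    using der_group_hom_eq[of f A f' a] assms that group_A by (simp add: auto_hom)
qed (use assms in \<open>auto simp: auto_def dest: Bij_imp_extensional\<close>)

lemma assoc_alpha_auto: "\<And>g. g \<in> carrier G \<Longrightarrow> \<Lambda> g \<in> auto A"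
  and assoc_alpha_gen: "\<And>g y. g \<in> carrier G \<Longrightarrow> y \<in> X \<Longrightarrow> \<Lambda> g (\<delta> y) = \<delta> (act g y)"
proof -
  have *: "\<Lambda> g \<in> auto A \<and> (\<forall>y\<in>X. \<Lambda> g (\<delta> y) = \<delta> (act g y))" if g: "g \<in> carrier G" for g
  proof -
    have bij: "bij_betw (act g) X X" using act_Bij[OF g] by (simp add: Bij_def)
    \<comment> \<open>Functoriality is applied with both solutions equal and
      \<open>h = act g\<close>.\<close>
    obtain F where F: "F \<in> iso A A" "\<And>y. y \<in> X \<Longrightarrow> F (\<delta> y) = \<delta> (act g y)"
      by (rule der_group_iso_exists[OF ybe_axioms ybe_axioms bij act_sigma[OF g]]) blast+
    have "bij_betw (restrict F (carrier A)) (carrier A) (carrier A)"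
      using F(1) by (simp add: iso_def cong: bij_betw_cong)
    then have "restrict F (carrier A) \<in> auto A"
      using F(1) by (auto simp: auto_def Bij_def iso_def hom_def)
    moreover have "\<forall>y\<in>X. restrict F (carrier A) (\<delta> y) = \<delta> (act g y)"
      using F(2) by simp
    ultimately have "\<exists>!f. f \<in> auto A \<and> (\<forall>y\<in>X. f (\<delta> y) = \<delta> (act g y))"
      by (intro ex1I[of _ "restrict F (carrier A)"] conjI auto_eqI) auto
    then show ?thesis unfolding assoc_alpha_def by (rule theI')
  qed
  show "\<And>g. g \<in> carrier G \<Longrightarrow> \<Lambda> g \<in> auto A"
    and "\<And>g y. g \<in> carrier G \<Longrightarrow> y \<in> X \<Longrightarrow> \<Lambda> g (\<delta> y) = \<delta> (act g y)"
    using * by blast+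
qed

lemma assoc_alpha_hom: "\<Lambda> \<in> hom G (AutoGroup A)"
proof (rule homI)
  fix g h assume g: "g \<in> carrier G" and h: "h \<in> carrier G"
  show "\<Lambda> (g \<otimes>\<^bsub>G\<^esub> h) = \<Lambda> g \<otimes>\<^bsub>AutoGroup A\<^esub> \<Lambda> h"
  proof (rule auto_eqI)
    show "\<Lambda> g \<otimes>\<^bsub>AutoGroup A\<^esub> \<Lambda> h \<in> auto A"
      using group.is_monoid[OF A.AutoGroup, THEN monoid.m_closed, of "\<Lambda> g" "\<Lambda> h"] g h
      by (simp add: assoc_alpha_auto)
  qed (use g h in \<open>simp_all add: A.AutoGroup_mult_apply assoc_alpha_auto assoc_alpha_gen act_mult\<close>)
qed (simp add: assoc_alpha_auto)

text \<open>In the linear part the relation for \<open>x\<close>, \<open>y\<close> holds because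
  \<open>\<Lambda>\<close> is a homomorphism on \<open>G\<close>. In the translation part it becomes
  the derived relation for the pair \<open>x\<close>, \<open>\<alpha> x y\<close>, rewritten by
  \<open>sigma_alpha\<close>.\<close>

lemma aff_hom_exists:
  obtains F where "F \<in> hom G (AffGroup A)" "\<And>x. x \<in> X \<Longrightarrow> F (\<gamma> x) = (\<Lambda> (\<gamma> x), \<delta> x)"
proof (rule str_group_hom_exists[OF A.group_AffGroup, of "\<lambda>x. (\<Lambda> (\<gamma> x), \<delta> x)"])
  fix x y assume x: "x \<in> X" and y: "y \<in> X"
  have "\<Lambda> (\<gamma> x) \<otimes>\<^bsub>AutoGroup A\<^esub> \<Lambda> (\<gamma> y) = \<Lambda> (\<gamma> (\<alpha> x y)) \<otimes>\<^bsub>AutoGroup A\<^esub> \<Lambda> (\<gamma> (\<beta> y x))"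
    using x y str_rel[OF x y] by (simp flip: hom_mult[OF assoc_alpha_hom])
  moreover have "\<delta> x \<otimes>\<^bsub>A\<^esub> \<delta> (\<alpha> x y) = \<delta> (\<alpha> x y) \<otimes>\<^bsub>A\<^esub> \<delta> (\<alpha> (\<alpha> x y) (\<beta> y x))"
    using der_rel[of x "\<alpha> x y"] sigma_alpha[OF x y] x y by simp
  ultimately show "(\<Lambda> (\<gamma> x), \<delta> x) \<otimes>\<^bsub>AffGroup A\<^esub> (\<Lambda> (\<gamma> y), \<delta> y) =
      (\<Lambda> (\<gamma> (\<alpha> x y)), \<delta> (\<alpha> x y)) \<otimes>\<^bsub>AffGroup A\<^esub> (\<Lambda> (\<gamma> (\<beta> y x)), \<delta> (\<beta> y x))"
    using x y by (simp add: assoc_alpha_gen act_gen_apply)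
qed (use that in \<open>auto simp: assoc_alpha_auto\<close>)

text \<open>A cocycle for \<open>\<Lambda>\<close> is the translation part of a homomorphism into
  the affine group with linear part \<open>\<Lambda>\<close>. Existence and uniqueness therefore
  both follow from the presentation of \<open>G\<close>.\<close>

lemma assoc_cocycle_exists:
  shows assoc_cocycle_closed: "\<And>g. g \<in> carrier G \<Longrightarrow> \<kappa> g \<in> carrier A"
    and assoc_cocycle_mult: "\<And>g h. g \<in> carrier G \<Longrightarrow> h \<in> carrier G \<Longrightarrow>
      \<kappa> (g \<otimes>\<^bsub>G\<^esub> h) = \<kappa> g \<otimes>\<^bsub>A\<^esub> \<Lambda> g (\<kappa> h)"
    and assoc_cocycle_gen: "\<And>x. x \<in> X \<Longrightarrow> \<kappa> (\<gamma> x) = \<delta> x"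
proof -
  let ?P = "\<lambda>b. b \<in> carrier G \<rightarrow>\<^sub>E carrier A \<and>
      (\<forall>g\<in>carrier G. \<forall>h\<in>carrier G. b (g \<otimes>\<^bsub>G\<^esub> h) = b g \<otimes>\<^bsub>A\<^esub> \<Lambda> g (b h)) \<and>
      (\<forall>x\<in>X. b (\<gamma> x) = \<delta> x)"
  obtain F where F: "F \<in> hom G (AffGroup A)" "\<And>x. x \<in> X \<Longrightarrow> F (\<gamma> x) = (\<Lambda> (\<gamma> x), \<delta> x)"
    by (rule aff_hom_exists) blast
  have F_closed: "fst (F g) \<in> auto A \<and> snd (F g) \<in> carrier A" if "g \<in> carrier G" for g
    using hom_in_carrier[OF F(1) that] by (auto simp: mem_Times_iff)
  have F_mult: "fst (F (g \<otimes>\<^bsub>G\<^esub> h)) = fst (F g) \<otimes>\<^bsub>AutoGroup A\<^esub> fst (F h)"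
    "snd (F (g \<otimes>\<^bsub>G\<^esub> h)) = snd (F g) \<otimes>\<^bsub>A\<^esub> fst (F g) (snd (F h))"
    if "g \<in> carrier G" "h \<in> carrier G" for g h
    using hom_mult[OF F(1) that] by (metis AffGroup_simps(2) prod.collapse fst_conv snd_conv)+
  have "(\<lambda>g. fst (F g)) \<in> hom G (AutoGroup A)"
    by (rule homI) (simp_all add: F_closed F_mult)
  then have fst_F: "fst (F g) = \<Lambda> g" if "g \<in> carrier G" for g
    using str_group_hom_eq[of "\<lambda>g. fst (F g)" "AutoGroup A" \<Lambda> g] that F(2)
    by (simp add: assoc_alpha_hom A.AutoGroup)
  have "?P (restrict (\<lambda>g. snd (F g)) (carrier G))"
    using F(2) by (simp add: F_closed F_mult fst_F)
  moreover have "b = restrict (\<lambda>g. snd (F g)) (carrier G)" if b: "?P b" for b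
  proof (rule extensionalityI)
    \<comment> \<open>Any competing cocycle is paired with \<open>\<Lambda>\<close> and compared
      with \<open>F\<close> on generators.\<close>
    have "(\<lambda>g. (\<Lambda> g, b g)) \<in> hom G (AffGroup A)"
      using b by (intro homI) (auto simp: assoc_alpha_auto hom_mult[OF assoc_alpha_hom])
    then have "(\<Lambda> g, b g) = F g" if "g \<in> carrier G" for g
      using str_group_hom_eq[OF _ F(1) A.group_AffGroup _ that] b F(2) by simp
    then show "b g = restrict (\<lambda>g. snd (F g)) (carrier G) g" if "g \<in> carrier G" for g
      using that by (simp flip: prod.inject) (metis snd_conv)
  qed (use b in \<open>auto simp: PiE_def\<close>)
  ultimately have "?P \<kappa>" unfolding assoc_cocycle_def by (rule theI)
  then show "\<And>g. g \<in> carrier G \<Longrightarrow> \<kappa> g \<in> carrier A"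
    "\<And>g h. g \<in> carrier G \<Longrightarrow> h \<in> carrier G \<Longrightarrow> \<kappa> (g \<otimes>\<^bsub>G\<^esub> h) = \<kappa> g \<otimes>\<^bsub>A\<^esub> \<Lambda> g (\<kappa> h)"
    "\<And>x. x \<in> X \<Longrightarrow> \<kappa> (\<gamma> x) = \<delta> x"
    by (auto simp: PiE_iff)
qed

section \<open>The affine action as an action on the derived group\<close>

abbreviation \<rho> where "\<rho> \<equiv> assoc_affine_action X R"

lemma assoc_affine_action_hom: "\<rho> \<in> hom G (AffGroup A)"
  by (rule homI)
    (simp_all add: assoc_affine_action_def assoc_alpha_auto assoc_cocycle_closed
      hom_mult[OF assoc_alpha_hom] assoc_cocycle_mult)

lemma assoc_alpha_closed [simp]: "g \<in> carrier G \<Longrightarrow> a \<in> carrier A \<Longrightarrow> \<Lambda> g a \<in> carrier A"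
  using hom_in_carrier[OF auto_hom[OF assoc_alpha_auto]] .

lemma assoc_apply: "aff_apply A (\<rho> g) a = \<kappa> g \<otimes>\<^bsub>A\<^esub> \<Lambda> g a"
  by (simp add: aff_apply_def assoc_affine_action_def)

lemma assoc_apply_closed:
  "g \<in> carrier G \<Longrightarrow> a \<in> carrier A \<Longrightarrow> aff_apply A (\<rho> g) a \<in> carrier A"
  by (simp add: assoc_apply assoc_cocycle_closed)

lemma assoc_apply_mult:
  assumes "g \<in> carrier G" "h \<in> carrier G" "a \<in> carrier A"
  shows "aff_apply A (\<rho> (g \<otimes>\<^bsub>G\<^esub> h)) a = aff_apply A (\<rho> g) (aff_apply A (\<rho> h) a)"
  using assms
  by (simp add: assoc_apply assoc_cocycle_closed assoc_cocycle_mult A.m_assoc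
      hom_mult[OF assoc_alpha_hom] A.AutoGroup_mult_apply assoc_alpha_auto
      hom_mult[OF auto_hom[OF assoc_alpha_auto]])

lemma assoc_alpha_one: "g \<in> carrier G \<Longrightarrow> \<Lambda> g \<one>\<^bsub>A\<^esub> = \<one>\<^bsub>A\<^esub>"
  using hom_one[OF auto_hom[OF assoc_alpha_auto] group_A group_A] .

text \<open>The cocycle is the orbit map of the neutral element, which makes it recoverable from any
  conjugacy.\<close>

lemma assoc_apply_one: "g \<in> carrier G \<Longrightarrow> aff_apply A (\<rho> g) \<one>\<^bsub>A\<^esub> = \<kappa> g"
  by (simp add: assoc_apply assoc_alpha_one assoc_cocycle_closed)

lemma assoc_apply_id:
  assumes "a \<in> carrier A"
  shows "aff_apply A (\<rho> \<one>\<^bsub>G\<^esub>) a = a"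
proof -
  have "\<rho> \<one>\<^bsub>G\<^esub> = \<one>\<^bsub>AffGroup A\<^esub>"
    using hom_one[OF assoc_affine_action_hom group_G A.group_AffGroup] .
  then show ?thesis
    using assms by (simp add: aff_apply_def AutoGroup_def BijGroup_def)
qed

end


section \<open>Injectivity of the generators of the derived group\<close>

locale injective_ybe = ybe +
  assumes inj: "ybe_injective X R"
begin

lemma str_gen_inject: "x \<in> X \<Longrightarrow> y \<in> X \<Longrightarrow> \<gamma> x = \<gamma> y \<Longrightarrow> x = y"
  using inj by (auto simp: ybe_injective_def inj_on_def)

text \<open>In the structure group \<open>p q = p (\<beta> q p)\<close> if \<open>\<alpha> p q = p\<close>, and \<open>p q = (\<alpha> p q) q\<close>
  if \<open>\<beta> q p = q\<close>; so for injective solutions the two equations are equivalent, and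
  \<open>p \<mapsto> (\<alpha> p)\<inverse> p\<close> and \<open>q \<mapsto> (\<beta> q)\<inverse> q\<close> are inverse to each other.\<close>

lemma fixed_pair_iff:
  assumes "p \<in> X" "q \<in> X"
  shows "\<alpha> p q = p \<longleftrightarrow> \<beta> q p = q"
proof
  assume "\<alpha> p q = p"
  then have "\<gamma> q = \<gamma> (\<beta> q p)" using str_rel[OF assms] assms by simp
  then show "\<beta> q p = q" using assms by (intro str_gen_inject[symmetric]) auto
next
  assume "\<beta> q p = q"
  then have "\<gamma> p = \<gamma> (\<alpha> p q)" using str_rel[OF assms] assms by simp
  then show "\<alpha> p q = p" using assms by (intro str_gen_inject[symmetric]) auto
qed

text \<open>Under the cocycle bijection, right multiplication by the generator \<open>x\<close> of the derived
  group becomes this permutation of the structure group.\<close>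

definition der_translation :: "'a \<Rightarrow> 'a gword set \<Rightarrow> 'a gword set"
  where "der_translation x = (\<lambda>g\<in>carrier G. g \<otimes>\<^bsub>G\<^esub> \<gamma> (act (inv\<^bsub>G\<^esub> g) x))"

text \<open>The map sends \<open>g\<close> to \<open>g \<otimes> \<gamma> p\<close>, where
  \<open>p\<close> is the image of \<open>x\<close> under the inverse of \<open>g\<close>. The new
  group element sees \<open>x\<close> as the point \<open>q\<close> with
  \<open>\<alpha> p q = p\<close>. By \<open>fixed_pair_iff\<close>, hence by injectivity of the
  solution, \<open>q\<close> determines \<open>p\<close>, and the step can be undone.\<close>

lemma der_translation_Bij:
  assumes x: "x \<in> X"
  shows "der_translation x \<in> Bij (carrier G)"
proof -
  \<comment> \<open>\<open>?E q\<close> is the point \<open>p\<close> with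
    \<open>\<beta> q p = q\<close>; \<open>?U\<close> removes the corresponding generator on the
    right.\<close>
  let ?E = "\<lambda>q. inv_into X (\<beta> q) q"
  let ?U = "\<lambda>k. k \<otimes>\<^bsub>G\<^esub> inv\<^bsub>G\<^esub> \<gamma> (?E (act (inv\<^bsub>G\<^esub> k) x))"
  have E: "?E q \<in> X" "\<beta> q (?E q) = q" if "q \<in> X" for q
    using bij_betw_apply[OF bij_betw_inv_into[OF bij_beta[OF that]] that]
      bij_betw_inv_into_right[OF bij_beta[OF that] that] by simp_all
  have "?U (der_translation x g) = g" if g: "g \<in> carrier G" for g
  proof -
    let ?p = "act (inv\<^bsub>G\<^esub> g) x"
    let ?q = "act (inv\<^bsub>G\<^esub> \<gamma> ?p) ?p"
    have p: "?p \<in> X" using g x by (intro act_closed) auto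
    then have q: "?q \<in> X" by simp
    have "\<alpha> ?p ?q = ?p"
      using p act_inv_right[of "\<gamma> ?p" ?p] act_gen_apply[OF p q] by simp
    then have "\<beta> ?q ?p = ?q" using p q by (simp add: fixed_pair_iff)
    then have "?E ?q = ?p" using bij_betw_inv_into_left[OF bij_beta[OF q] p] by simp
    moreover have "act (inv\<^bsub>G\<^esub> der_translation x g) x = ?q"
      using g p x by (simp add: der_translation_def G.inv_mult_group act_mult)
    ultimately show ?thesis
      using g p by (simp add: der_translation_def G.m_assoc)
  qed
  moreover have "der_translation x (?U k) = k \<and> ?U k \<in> carrier G" if k: "k \<in> carrier G" for k
  proof -
    let ?q = "act (inv\<^bsub>G\<^esub> k) x"
    have q: "?q \<in> X" using k x by (intro act_closed) auto
    note p = E[OF q]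
    have "act (inv\<^bsub>G\<^esub> ?U k) x = \<alpha> (?E ?q) ?q"
      using k p x q by (simp add: G.inv_mult_group act_mult act_gen_apply)
    also have "\<dots> = ?E ?q" using p q by (simp add: fixed_pair_iff)
    finally show ?thesis
      using k p by (simp add: der_translation_def G.m_assoc)
  qed
  moreover have "der_translation x g \<in> carrier G" if "g \<in> carrier G" for g
    using that x by (simp add: der_translation_def)
  ultimately have "bij_betw (der_translation x) (carrier G) (carrier G)"
    by (intro bij_betw_byWitness[where f' = ?U]) auto
  then show ?thesis by (simp add: Bij_def der_translation_def)
qed

text \<open>Transporting \<open>x\<close>, \<open>y\<close> by the inverse of \<open>g\<close> gives
  \<open>?p\<close>, \<open>?q\<close>, and this transport respects \<sigma>. With
  \<open>?q = \<alpha> ?p r\<close> the two sides append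
  \<open>\<gamma> ?p \<otimes> \<gamma> r\<close> and
  \<open>\<gamma> ?q \<otimes> \<gamma> (\<beta> r ?p)\<close> to \<open>g\<close>, which are equal
  by \<open>str_rel\<close>.\<close>

lemma der_translation_rel:
  assumes x: "x \<in> X" and y: "y \<in> X" and g: "g \<in> carrier G"
  shows "der_translation y (der_translation x g) =
    der_translation (\<sigma> y x) (der_translation y g)"
proof -
  let ?p = "act (inv\<^bsub>G\<^esub> g) x" and ?q = "act (inv\<^bsub>G\<^esub> g) y"
  have p: "?p \<in> X" and q: "?q \<in> X" using x y g by (auto intro!: act_closed)
  obtain r where r: "r \<in> X" "?q = \<alpha> ?p r" using p q by (rule alpha_surjE)
  have inv_gen: "act (inv\<^bsub>G\<^esub> \<gamma> u) (\<alpha> u v) = v" if "u \<in> X" "v \<in> X" for u v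
    using act_inv_left[of "\<gamma> u" v] act_gen_apply[OF that] that by simp
  have "der_translation y (der_translation x g) = g \<otimes>\<^bsub>G\<^esub> \<gamma> ?p \<otimes>\<^bsub>G\<^esub> \<gamma> (act (inv\<^bsub>G\<^esub> \<gamma> ?p) ?q)"
    using g p y by (simp add: der_translation_def G.inv_mult_group act_mult)
  also have "\<dots> = g \<otimes>\<^bsub>G\<^esub> (\<gamma> ?p \<otimes>\<^bsub>G\<^esub> \<gamma> r)"
    using r p g inv_gen[OF p r(1)] by (simp add: G.m_assoc)
  also have "\<dots> = g \<otimes>\<^bsub>G\<^esub> (\<gamma> ?q \<otimes>\<^bsub>G\<^esub> \<gamma> (\<beta> r ?p))"
    using str_rel[OF p r(1)] r by simp
  also have "\<beta> r ?p = act (inv\<^bsub>G\<^esub> \<gamma> ?q) (\<sigma> ?q ?p)"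
    using sigma_alpha[OF p r(1)] inv_gen[OF q, of "\<beta> r ?p"] p r by simp
  also have "\<sigma> ?q ?p = act (inv\<^bsub>G\<^esub> g) (\<sigma> y x)"
    using act_sigma[of "inv\<^bsub>G\<^esub> g" x y] g x y by simp
  also have "g \<otimes>\<^bsub>G\<^esub> (\<gamma> ?q \<otimes>\<^bsub>G\<^esub> \<gamma> (act (inv\<^bsub>G\<^esub> \<gamma> ?q) (act (inv\<^bsub>G\<^esub> g) (\<sigma> y x)))) =
      der_translation (\<sigma> y x) (der_translation y g)"
    using g q x y by (simp add: der_translation_def G.inv_mult_group act_mult G.m_assoc)
  finally show ?thesis .
qed

lemma der_gen_inject:
  assumes u: "u \<in> X" and v: "v \<in> X" and eq: "\<delta> u = \<delta> v"
  shows "u = v"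
proof -
  let ?B = "BijGroup (carrier G)"
  interpret B: group ?B by (rule group_BijGroup)
  have T: "der_translation x \<in> carrier ?B" if "x \<in> X" for x
    using der_translation_Bij[OF that] by (simp add: carrier_BijGroup)
  \<comment> \<open>Right translations compose in reverse order, so the inverse permutations are the
    ones satisfying the relations of \<open>A\<close>.\<close>
  obtain F where F: "\<And>x. x \<in> X \<Longrightarrow> F (\<delta> x) = inv\<^bsub>?B\<^esub> der_translation x"
  proof (rule der_group_hom_exists[OF group_BijGroup, of "\<lambda>x. inv\<^bsub>?B\<^esub> der_translation x"])
    fix x y assume x: "x \<in> X" and y: "y \<in> X"
    have "der_translation y \<otimes>\<^bsub>?B\<^esub> der_translation x =
        der_translation (\<sigma> y x) \<otimes>\<^bsub>?B\<^esub> der_translation y"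
      using x y der_translation_rel[OF x y]
      by (auto simp: BijGroup_def der_translation_Bij compose_def fun_eq_iff)
    then show "inv\<^bsub>?B\<^esub> der_translation x \<otimes>\<^bsub>?B\<^esub> inv\<^bsub>?B\<^esub> der_translation y =
        inv\<^bsub>?B\<^esub> der_translation y \<otimes>\<^bsub>?B\<^esub> inv\<^bsub>?B\<^esub> der_translation (\<sigma> y x)"
      using x y T by (simp flip: B.inv_mult_group)
  qed (use T that in auto)
  have "der_translation u = der_translation v"
    using F[OF u] F[OF v] eq T[OF u] T[OF v] by (metis B.inv_inv)
  then have "der_translation u \<one>\<^bsub>G\<^esub> = der_translation v \<one>\<^bsub>G\<^esub>" by simp
  then have "\<gamma> u = \<gamma> v" using u v by (simp add: der_translation_def act_one)
  then show ?thesis using u v by (intro str_gen_inject)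
qed

end


section \<open>Isomorphic solutions and conjugate affine actions\<close>

lemma isomorphic_imp_conjugate:
  assumes "ybe X R" "ybe Y S" and "ybe_isomorphic X R Y S"
  shows "\<exists>\<phi> \<in> iso (str_group X R) (str_group Y S).
    \<phi> ` str_gen X R ` X = str_gen Y S ` Y \<and>
    affine_conjugate (str_group X R) (der_group X R) (assoc_affine_action X R)
      (der_group Y S) (assoc_affine_action Y S \<circ> \<phi>)"
proof -
  interpret X: ybe X R by fact
  interpret Y: ybe Y S by fact
  obtain h where h: "bij_betw h X Y"
    and iso: "\<And>p. p \<in> X \<times> X \<Longrightarrow> S (map_prod h h p) = map_prod h h (R p)"
    using assms(3) by (auto simp: ybe_isomorphic_def)
  have alpha: "h (X.\<alpha> x y) = Y.\<alpha> (h x) (h y)" and beta: "h (X.\<beta> y x) = Y.\<beta> (h y) (h x)"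
    if "x \<in> X" "y \<in> X" for x y
    using iso[of "(x, y)"] that by (simp_all add: ybe_alpha_def ybe_beta_def prod_eq_iff)
  have hY: "h x \<in> Y" if "x \<in> X" for x using h that by (rule bij_betw_apply)
  have sigma: "h (X.\<sigma> y x) = Y.\<sigma> (h y) (h x)" if x: "x \<in> X" and y: "y \<in> X" for x y
  proof -
    \<comment> \<open>After this substitution \<sigma> is a term in \<alpha> and \<beta> alone, both
      of which \<open>h\<close> preserves.\<close>
    obtain w where "w \<in> X" "y = X.\<alpha> x w" using x y by (rule X.alpha_surjE)
    then show ?thesis
      using x by (simp add: X.sigma_alpha Y.sigma_alpha alpha beta hY)
  qed
  obtain \<phi> where \<phi>: "\<phi> \<in> iso X.G Y.G" "\<And>x. x \<in> X \<Longrightarrow> \<phi> (X.\<gamma> x) = Y.\<gamma> (h x)"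
    by (rule str_group_iso_exists[OF assms(1,2) h iso]) blast+
  obtain \<psi> where \<psi>: "\<psi> \<in> iso X.A Y.A" "\<And>x. x \<in> X \<Longrightarrow> \<psi> (X.\<delta> x) = Y.\<delta> (h x)"
    by (rule der_group_iso_exists[OF assms(1,2) h sigma]) blast+
  interpret \<phi>: group_hom X.G Y.G \<phi>
    using \<phi>(1) by (simp add: group_hom_def group_hom_axioms_def iso_def X.group_G Y.group_G)
  interpret \<psi>: group_hom X.A Y.A \<psi>
    using \<psi>(1) by (simp add: group_hom_def group_hom_axioms_def iso_def X.group_A Y.group_A)
  \<comment> \<open>Both sides come from actions of \<open>X.G\<close>, so the identity spreads from
    generators; keeping \<open>a\<close> arbitrary allows the product and inverse cases.\<close>
  have "\<psi> (aff_apply X.A (X.\<rho> g) a) = aff_apply Y.A (Y.\<rho> (\<phi> g)) (\<psi> a)"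
    if "g \<in> carrier X.G" "a \<in> carrier X.A" for g a
    using that
  proof (induction arbitrary: a rule: X.str_group_induct)
    case one
    then show ?case by (simp add: X.assoc_apply_id Y.assoc_apply_id)
  next
    case (gen x)
    have x: "X.\<gamma> x \<in> carrier X.G" "Y.\<gamma> (h x) \<in> carrier Y.G" using gen hY by simp_all
    \<comment> \<open>For a generator only the linear parts remain to be matched: these are two
      homomorphisms agreeing on all \<open>X.\<delta> y\<close>.\<close>
    have "(\<psi> \<circ> X.\<Lambda> (X.\<gamma> x)) a = (Y.\<Lambda> (Y.\<gamma> (h x)) \<circ> \<psi>) a"
    proof (rule X.der_group_hom_eq[OF _ _ Y.group_A _ gen(2)])
      show "\<psi> \<circ> X.\<Lambda> (X.\<gamma> x) \<in> hom X.A Y.A"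
        using auto_hom[OF X.assoc_alpha_auto[OF x(1)]] \<psi>.homh by (rule hom_compose)
      show "Y.\<Lambda> (Y.\<gamma> (h x)) \<circ> \<psi> \<in> hom X.A Y.A"
        using \<psi>.homh auto_hom[OF Y.assoc_alpha_auto[OF x(2)]] by (rule hom_compose)
    qed (use gen(1) in \<open>simp add: \<psi>(2) hY X.assoc_alpha_gen Y.assoc_alpha_gen
        X.act_gen_apply Y.act_gen_apply alpha\<close>)
    then show ?case
      using gen by (simp add: X.assoc_apply Y.assoc_apply X.assoc_cocycle_gen
          Y.assoc_cocycle_gen \<phi>(2) \<psi>(2) hY)
  next
    case (mult g h)
    then show ?case
      by (simp add: X.assoc_apply_mult Y.assoc_apply_mult X.assoc_apply_closed)
  next
    case (inv g)
    \<comment> \<open>This is the preimage of \<open>a\<close> under \<open>g\<close>; the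
      hypothesis at \<open>?b\<close> is then cancelled on the \<open>Y\<close> side by the inverse
      of \<open>\<phi> g\<close>.\<close>
    let ?b = "aff_apply X.A (X.\<rho> (inv\<^bsub>X.G\<^esub> g)) a"
    have b: "?b \<in> carrier X.A" using inv by (intro X.assoc_apply_closed) auto
    have "aff_apply Y.A (Y.\<rho> (\<phi> (inv\<^bsub>X.G\<^esub> g))) (\<psi> a) =
        aff_apply Y.A (Y.\<rho> (\<phi> (inv\<^bsub>X.G\<^esub> g))) (\<psi> (aff_apply X.A (X.\<rho> g) ?b))"
      using inv by (simp flip: X.assoc_apply_mult add: X.assoc_apply_id del: \<phi>.hom_inv)
    also have "\<dots> = aff_apply Y.A (Y.\<rho> (\<phi> (inv\<^bsub>X.G\<^esub> g))) (aff_apply Y.A (Y.\<rho> (\<phi> g)) (\<psi> ?b))"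
      using inv.IH[OF b] by simp
    also have "\<dots> = \<psi> ?b"
      using inv.hyps b by (simp flip: Y.assoc_apply_mult add: Y.assoc_apply_id)
    finally show ?case by simp
  qed
  moreover have "affine_action X.G X.A X.\<rho>"
    unfolding affine_action_def by (rule X.assoc_affine_action_hom)
  moreover have "affine_action X.G Y.A (Y.\<rho> \<circ> \<phi>)"
    unfolding affine_action_def using \<phi>.homh Y.assoc_affine_action_hom by (rule hom_compose)
  ultimately have "affine_conjugate X.G X.A X.\<rho> Y.A (Y.\<rho> \<circ> \<phi>)"
    using \<psi>(1) by (auto simp: affine_conjugate_def)
  moreover have "\<phi> ` X.\<gamma> ` X = Y.\<gamma> ` Y"
    using bij_betw_imp_surj_on[OF h] \<phi>(2) by (force simp: image_image)
  ultimately show ?thesis using \<phi>(1) by blast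
qed

lemma conjugate_imp_isomorphic:
  assumes "injective_ybe X R" "injective_ybe Y S"
    and \<phi>: "\<phi> \<in> iso (str_group X R) (str_group Y S)"
    and gens: "\<phi> ` str_gen X R ` X = str_gen Y S ` Y"
    and conj: "affine_conjugate (str_group X R) (der_group X R) (assoc_affine_action X R)
      (der_group Y S) (assoc_affine_action Y S \<circ> \<phi>)"
  shows "ybe_isomorphic X R Y S"
proof -
  interpret X: injective_ybe X R by fact
  interpret Y: injective_ybe Y S by fact
  interpret \<phi>: group_hom X.G Y.G \<phi>
    using \<phi> by (simp add: group_hom_def group_hom_axioms_def iso_def X.group_G Y.group_G)
  obtain \<psi> where \<psi>: "\<psi> \<in> iso X.A Y.A"
    and conj: "\<And>g a. g \<in> carrier X.G \<Longrightarrow> a \<in> carrier X.A \<Longrightarrow>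
      \<psi> (aff_apply X.A (X.\<rho> g) a) = aff_apply Y.A (Y.\<rho> (\<phi> g)) (\<psi> a)"
    using conj by (auto simp: affine_conjugate_def)
  interpret \<psi>: group_hom X.A Y.A \<psi>
    using \<psi> by (simp add: group_hom_def group_hom_axioms_def iso_def X.group_A Y.group_A)
  have "\<forall>x\<in>X. \<exists>y\<in>Y. \<phi> (X.\<gamma> x) = Y.\<gamma> y" using gens by blast
  then obtain h where h: "\<And>x. x \<in> X \<Longrightarrow> h x \<in> Y" "\<And>x. x \<in> X \<Longrightarrow> \<phi> (X.\<gamma> x) = Y.\<gamma> (h x)"
    by metis
  have phi_inj: "inj_on \<phi> (carrier X.G)" using \<phi> by (simp add: iso_def bij_betw_def)
  have "inj_on h X"
  proof (rule inj_onI)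
    fix x y assume x: "x \<in> X" and y: "y \<in> X" and "h x = h y"
    then have "\<phi> (X.\<gamma> x) = \<phi> (X.\<gamma> y)" by (simp add: h)
    then have "X.\<gamma> x = X.\<gamma> y" using x y by (intro inj_onD[OF phi_inj]) auto
    then show "x = y" using x y by (intro X.str_gen_inject)
  qed
  moreover have "h ` X = Y"
  proof
    show "Y \<subseteq> h ` X"
    proof
      fix y assume y: "y \<in> Y"
      then have "Y.\<gamma> y \<in> \<phi> ` X.\<gamma> ` X" using gens by simp
      then obtain x where x: "x \<in> X" "Y.\<gamma> y = \<phi> (X.\<gamma> x)" by blast
      \<comment> \<open>\<open>gens\<close> yields only equality of images in \<open>Y.G\<close>;
        injectivity of the second solution lifts it to \<open>Y\<close>.\<close>
      then have "y = h x" using y h by (intro Y.str_gen_inject) auto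
      then show "y \<in> h ` X" using x by simp
    qed
  qed (use h in auto)
  ultimately have bij: "bij_betw h X Y" by (simp add: bij_betw_def)
  have cocycle: "\<psi> (X.\<kappa> g) = Y.\<kappa> (\<phi> g)" if "g \<in> carrier X.G" for g
    using conj[OF that X.A.one_closed] that by (simp add: X.assoc_apply_one Y.assoc_apply_one)
  have psi_gen: "\<psi> (X.\<delta> x) = Y.\<delta> (h x)" if "x \<in> X" for x
    using cocycle[of "X.\<gamma> x"] that h by (simp add: X.assoc_cocycle_gen Y.assoc_cocycle_gen)
  have alpha: "h (X.\<alpha> x y) = Y.\<alpha> (h x) (h y)" if x: "x \<in> X" and y: "y \<in> X" for x y
  proof (rule Y.der_gen_inject)
    \<comment> \<open>The translation parts on the two sides agree by \<open>psi_gen\<close> and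
      cancel on the left.\<close>
    have "\<psi> (X.\<Lambda> (X.\<gamma> x) (X.\<delta> y)) = Y.\<Lambda> (Y.\<gamma> (h x)) (Y.\<delta> (h y))"
      using conj[of "X.\<gamma> x" "X.\<delta> y"] x y h
      by (simp add: X.assoc_apply Y.assoc_apply X.assoc_cocycle_gen Y.assoc_cocycle_gen psi_gen)
    then show "Y.\<delta> (h (X.\<alpha> x y)) = Y.\<delta> (Y.\<alpha> (h x) (h y))"
      using x y h by (simp add: X.assoc_alpha_gen Y.assoc_alpha_gen X.act_gen_apply
          Y.act_gen_apply psi_gen)
  qed (use x y h in auto)
  have beta: "h (X.\<beta> y x) = Y.\<beta> (h y) (h x)" if x: "x \<in> X" and y: "y \<in> X" for x y
  proof (rule Y.str_gen_inject)
    \<comment> \<open>The image under \<open>\<phi>\<close> of the relation for \<open>x\<close>,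
      \<open>y\<close> is compared with the relation for \<open>h x\<close>, \<open>h y\<close>; by
      \<open>alpha\<close> they share the left factor.\<close>
    have "Y.\<gamma> (h (X.\<alpha> x y)) \<otimes>\<^bsub>Y.G\<^esub> Y.\<gamma> (h (X.\<beta> y x)) =
        \<phi> (X.\<gamma> (X.\<alpha> x y) \<otimes>\<^bsub>X.G\<^esub> X.\<gamma> (X.\<beta> y x))"
      using x y by (simp add: h)
    also have "\<dots> = \<phi> (X.\<gamma> x \<otimes>\<^bsub>X.G\<^esub> X.\<gamma> y)"
      using X.str_rel[OF x y] by simp
    also have "\<dots> = Y.\<gamma> (h x) \<otimes>\<^bsub>Y.G\<^esub> Y.\<gamma> (h y)"
      using x y by (simp add: h)
    also have "\<dots> = Y.\<gamma> (h (X.\<alpha> x y)) \<otimes>\<^bsub>Y.G\<^esub> Y.\<gamma> (Y.\<beta> (h y) (h x))"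
      using Y.str_rel[of "h x" "h y"] x y by (simp add: h alpha)
    finally show "Y.\<gamma> (h (X.\<beta> y x)) = Y.\<gamma> (Y.\<beta> (h y) (h x))"
      using x y h by simp
  qed (use x y h in auto)
  have "S (map_prod h h p) = map_prod h h (R p)" if "p \<in> X \<times> X" for p
    using that alpha beta by (auto simp: ybe_alpha_def ybe_beta_def prod_eq_iff)
  then show ?thesis using bij by (auto simp: ybe_isomorphic_def)
qed

theorem theorem3p3:
  fixes X :: "'a set" and R\<^sub>X :: "'a \<times> 'a \<Rightarrow> 'a \<times> 'a"
    and Y :: "'b set" and R\<^sub>Y :: "'b \<times> 'b \<Rightarrow> 'b \<times> 'b"
  assumes "ybe_solution X R\<^sub>X" and "ybe_injective X R\<^sub>X"
    and "ybe_solution Y R\<^sub>Y" and "ybe_injective Y R\<^sub>Y"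
  shows "ybe_isomorphic X R\<^sub>X Y R\<^sub>Y \<longleftrightarrow>
    (\<exists>\<phi> \<in> iso (str_group X R\<^sub>X) (str_group Y R\<^sub>Y).
      \<phi> ` str_gen X R\<^sub>X ` X = str_gen Y R\<^sub>Y ` Y \<and>
      affine_conjugate (str_group X R\<^sub>X)
        (der_group X R\<^sub>X) (assoc_affine_action X R\<^sub>X)
        (der_group Y R\<^sub>Y) (assoc_affine_action Y R\<^sub>Y \<circ> \<phi>))"
proof -
  have "injective_ybe X R\<^sub>X" "injective_ybe Y R\<^sub>Y"
    using assms by (simp_all add: injective_ybe_def ybe_def injective_ybe_axioms_def)
  then show ?thesis
    using isomorphic_imp_conjugate conjugate_imp_isomorphic
    by (metis injective_ybe.axioms(1))
qed

end
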